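(* Let ${}_AE_A$ and $X$ be the C*-correspondence and the subproduct system, respectively, of a monomial ideal $\mathcal I$ in $\mathbb C\langle x_1,\dots,x_d\rangle$. Then there is a completely isometric embedding (algebra homomorphism) $\mathcal A_X\hookrightarrow\mathcal T_E^+$.
   Context: $\mathbb F_+^d$ is the free monoid of words in $\{1,\dots,d\}$; for $\mu=\mu_1\cdots\mu_n$ put $x^\mu=x_{\mu_1}\cdots x_{\mu_n}$ in the ring $\mathbb C\langle x_1,\dots,x_d\rangle$ of polynomials in noncommuting variables. A monomial ideal is a two-sided ideal generated by monomials; throughout, monomial ideals are generated by monomials of degree at least 2 (the zero ideal is allowed). Put $\Lambda^*=\{\mu: x^\mu\notin\mathcal I\}$. The subproduct system $X$ of $\mathcal I$ has fibres $X(n)=\mathrm{span}\{e_\mu:\mu\in\Lambda^*,|\mu|=n\}$; $\mathcal F_X$ is the Hilbert space with orthonormal basis $\{e_\mu:\mu\in\Lambda^*\}$, and $T_ie_\nu=e_{i\nu}$ if $i\nu\in\Lambda^*$, $T_ie_\nu=0$ otherwise; $T_\mu=T_{\mu_1}\cdots T_{\mu_n}$, $T_\emptyset=I$. The tensor algebra $\mathcal A_X$ is the norm-closed algebra generated by $I,T_1,\dots,T_d$. $A=C^*(T_\mu^*T_\mu:\mu\in\Lambda^* )$ is unital and commutative, and $E=\overline{\mathrm{span}}\{T_ia: a\in A,\ i=1,\dots,d\}$ is a C*-correspondence over $A$ with $a\cdot\xi\cdot b=a\xi b$, $\langle\xi,\eta\rangle=\xi^*\eta$ and left action $\phi_E$.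 $\mathcal T_E$ is the universal C*-algebra generated by $A$ and $E$ for pairs $(\pi,t)$, $\pi$ a $*$-representation of $A$ and $t$ a linear map on $E$ with $t(\xi)^*t(\eta)=\pi(\langle\xi,\eta\rangle)$ and $\pi(a)t(\xi)=t(\phi_E(a)\xi)$. $\mathcal T_E^+$ is the norm-closed subalgebra of $\mathcal T_E$ generated by $A$ and $E$. *)

theory Defs
  imports "HOL-Analysis.Analysis" "HOL-Library.Poly_Mapping"
begin

section \<open>Complex vector spaces and the Hilbert spaces of square-summable families\<close>

class complex_vector = real_vector +
  fixes scaleC :: "complex \<Rightarrow> 'a \<Rightarrow> 'a"  (infixr \<open>*\<^sub>C\<close> 75)
  assumes scaleC_add_right: "c *\<^sub>C (x + y) = c *\<^sub>C x + c *\<^sub>C y"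
    and scaleC_add_left: "(b + c) *\<^sub>C x = b *\<^sub>C x + c *\<^sub>C x"
    and scaleC_scaleC: "b *\<^sub>C c *\<^sub>C x = (b * c) *\<^sub>C x"
    and scaleC_one: "1 *\<^sub>C x = x"
    and scaleR_scaleC: "r *\<^sub>R x = complex_of_real r *\<^sub>C x"

lemma scaleC_scaleR: "c *\<^sub>C r *\<^sub>R x = r *\<^sub>R c *\<^sub>C (x::'a::complex_vector)"
  by (simp add: scaleR_scaleC scaleC_scaleC mult.commute)

lemma scaleC_zero [simp]: "c *\<^sub>C 0 = (0::'a::complex_vector)"
  using scaleC_scaleR[of c 0 0] by simp

definition csubspace :: "'a::complex_vector set \<Rightarrow> bool" where
  "csubspace S \<longleftrightarrow> 0 \<in> S \<and> (\<forall>x\<in>S. \<forall>y\<in>S. x + y \<in> S) \<and> (\<forall>c. \<forall>x\<in>S. c *\<^sub>C x \<in> S)"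

definition clinear_on :: "'a::complex_vector set \<Rightarrow> ('a \<Rightarrow> 'b::complex_vector) \<Rightarrow> bool" where
  "clinear_on S f \<longleftrightarrow>
     (\<forall>x\<in>S. \<forall>y\<in>S. f (x + y) = f x + f y) \<and> (\<forall>c. \<forall>x\<in>S. f (c *\<^sub>C x) = c *\<^sub>C f x)"

definition square_summable :: "('i \<Rightarrow> complex) \<Rightarrow> bool" where
  "square_summable f \<longleftrightarrow> (\<lambda>i. (cmod (f i))\<^sup>2) summable_on UNIV"

lemma square_summableI:
  assumes "\<And>F. finite F \<Longrightarrow> L2_set (\<lambda>i. cmod (f i)) F \<le> B"
  shows "square_summable f"
proof -
  have "(\<Sum>i\<in>F. (cmod (f i))\<^sup>2) \<le> B\<^sup>2" if "finite F" for F
    using assms[OF that] unfolding L2_set_def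
    by (metis real_sqrt_ge_zero real_sqrt_le_iff real_sqrt_pow2 sum_nonneg power_mono zero_le_power2)
  then show ?thesis
    unfolding square_summable_def
    by (intro nonneg_bdd_above_summable_on) (auto intro!: bdd_aboveI)
qed

lemma L2_set_le_infsum:
  assumes "square_summable f" "finite F"
  shows "L2_set (\<lambda>i. cmod (f i)) F \<le> sqrt (\<Sum>\<^sub>\<infinity>i. (cmod (f i))\<^sup>2)"
  using assms unfolding square_summable_def L2_set_def
  by (intro real_sqrt_le_mono finite_sum_le_infsum) auto

lemma square_summable_add:
  assumes "square_summable f" "square_summable g"
  shows "square_summable (\<lambda>i. f i + g i)"
proof (rule square_summableI)
  fix F :: "'a set" assume F: "finite F"
  have "L2_set (\<lambda>i. cmod (f i + g i)) F \<le> L2_set (\<lambda>i. cmod (f i) + cmod (g i)) F"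
    by (intro L2_set_mono norm_triangle_ineq) auto
  also have "\<dots> \<le> L2_set (\<lambda>i. cmod (f i)) F + L2_set (\<lambda>i. cmod (g i)) F"
    by (rule L2_set_triangle_ineq)
  also have "\<dots> \<le> sqrt (\<Sum>\<^sub>\<infinity>i. (cmod (f i))\<^sup>2) + sqrt (\<Sum>\<^sub>\<infinity>i. (cmod (g i))\<^sup>2)"
    by (intro add_mono L2_set_le_infsum assms F)
  finally show "L2_set (\<lambda>i. cmod (f i + g i)) F \<le>
      sqrt (\<Sum>\<^sub>\<infinity>i. (cmod (f i))\<^sup>2) + sqrt (\<Sum>\<^sub>\<infinity>i. (cmod (g i))\<^sup>2)" .
qed

lemma square_summable_scale: "square_summable f \<Longrightarrow> square_summable (\<lambda>i. c * f i)"
  unfolding square_summable_def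
  by (simp add: norm_mult power_mult_distrib summable_on_cmult_right)

lemma square_summable_cinner:
  assumes "square_summable f" "square_summable g"
  shows "(\<lambda>i. cnj (f i) * g i) summable_on UNIV"
proof -
  have "(\<lambda>i. (cmod (f i))\<^sup>2 + (cmod (g i))\<^sup>2) summable_on UNIV"
    using assms unfolding square_summable_def by (rule summable_on_add)
  then have *: "(\<lambda>i. norm ((cmod (f i))\<^sup>2 + (cmod (g i))\<^sup>2)) summable_on UNIV"
    by simp
  have "(\<lambda>i. norm (cnj (f i) * g i)) summable_on UNIV"
  proof (rule Infinite_Sum.abs_summable_on_comparison_test[OF *])
    fix i
    have "2 * (cmod (f i) * cmod (g i)) \<le> (cmod (f i))\<^sup>2 + (cmod (g i))\<^sup>2"
      using sum_squares_bound[of "cmod (f i)" "cmod (g i)"] by simp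
    moreover have "0 \<le> cmod (f i) * cmod (g i)" by simp
    ultimately have "cmod (f i) * cmod (g i) \<le> (cmod (f i))\<^sup>2 + (cmod (g i))\<^sup>2" by linarith
    then show "norm (cnj (f i) * g i) \<le> norm ((cmod (f i))\<^sup>2 + (cmod (g i))\<^sup>2)"
      by (simp add: norm_mult)
  qed
  then show ?thesis
    by (simp add: summable_on_iff_abs_summable_on_complex)
qed

typedef 'i ell2 = "{f :: 'i \<Rightarrow> complex. square_summable f}"
  morphisms ell2_apply Abs_ell2
  by (rule exI[of _ "\<lambda>_. 0"]) (simp add: square_summable_def)

setup_lifting type_definition_ell2

lemma ell2_apply_square_summable: "square_summable (ell2_apply x)"
  using ell2_apply by auto

instantiation ell2 :: (type) complex_vector
begin

lift_definition zero_ell2 :: "'a ell2" is "\<lambda>_. 0" by (simp add: square_summable_def)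
lift_definition plus_ell2 :: "'a ell2 \<Rightarrow> 'a ell2 \<Rightarrow> 'a ell2" is "\<lambda>f g i. f i + g i"
  by (rule square_summable_add)
lift_definition uminus_ell2 :: "'a ell2 \<Rightarrow> 'a ell2" is "\<lambda>f i. - f i"
  by (simp add: square_summable_def)
lift_definition minus_ell2 :: "'a ell2 \<Rightarrow> 'a ell2 \<Rightarrow> 'a ell2" is "\<lambda>f g i. f i - g i"
  using square_summable_add[OF _ square_summable_scale[of _ "-1"]] by simp
lift_definition scaleR_ell2 :: "real \<Rightarrow> 'a ell2 \<Rightarrow> 'a ell2" is "\<lambda>r f i. complex_of_real r * f i"
  by (rule square_summable_scale)
lift_definition scaleC_ell2 :: "complex \<Rightarrow> 'a ell2 \<Rightarrow> 'a ell2" is "\<lambda>c f i. c * f i"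
  by (rule square_summable_scale)

instance
  by (standard; transfer) (auto simp: algebra_simps)

end

text \<open>The inner product is conjugate-linear in the first variable.\<close>

lift_definition cinner :: "'i ell2 \<Rightarrow> 'i ell2 \<Rightarrow> complex"
  is "\<lambda>f g. \<Sum>\<^sub>\<infinity>i. cnj (f i) * g i" .

lemma cinner_add_left: "cinner (x + y) z = cinner x z + cinner y z"
  by transfer (simp add: distrib_right infsum_add square_summable_cinner)

lemma cinner_add_right: "cinner x (y + z) = cinner x y + cinner x z"
  by transfer (simp add: distrib_left infsum_add square_summable_cinner)

lemma cinner_scaleC_left: "cinner (c *\<^sub>C x) y = cnj c * cinner x y"
  by transfer (simp add: mult.assoc infsum_cmult_right')

lemma cinner_scaleC_right: "cinner x (c *\<^sub>C y) = c * cinner x y"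
  by transfer (simp add: mult.left_commute infsum_cmult_right')

lemma cinner_commute: "cinner x y = cnj (cinner y x)"
  by transfer (simp flip: infsum_cnj add: mult.commute)

lemma cinner_self: "cinner x x = complex_of_real (\<Sum>\<^sub>\<infinity>i. (cmod (ell2_apply x i))\<^sup>2)"
proof -
  have "((\<lambda>i. complex_of_real ((cmod (ell2_apply x i))\<^sup>2)) has_sum
      complex_of_real (\<Sum>\<^sub>\<infinity>i. (cmod (ell2_apply x i))\<^sup>2)) UNIV"
    using ell2_apply_square_summable[of x] unfolding square_summable_def
    by (intro has_sum_of_real has_sum_infsum)
  then show ?thesis
    unfolding cinner.rep_eq
    by (intro infsumI) (simp only: complex_norm_square mult.commute)
qed

instantiation ell2 :: (type) real_inner
begin

definition inner_ell2 :: "'a ell2 \<Rightarrow> 'a ell2 \<Rightarrow> real" where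
  "inner_ell2 x y = Re (cinner x y)"
definition norm_ell2 :: "'a ell2 \<Rightarrow> real" where
  "norm_ell2 x = sqrt (\<Sum>\<^sub>\<infinity>i. (cmod (ell2_apply x i))\<^sup>2)"
definition dist_ell2 :: "'a ell2 \<Rightarrow> 'a ell2 \<Rightarrow> real" where
  "dist_ell2 x y = norm (x - y)"
definition sgn_ell2 :: "'a ell2 \<Rightarrow> 'a ell2" where
  "sgn_ell2 x = x /\<^sub>R norm x"
definition uniformity_ell2 :: "('a ell2 \<times> 'a ell2) filter" where
  "uniformity_ell2 = (INF e\<in>{0<..}. principal {(x, y). dist x y < e})"
definition open_ell2 :: "'a ell2 set \<Rightarrow> bool" where
  "open_ell2 S = (\<forall>x\<in>S. \<forall>\<^sub>F (x', y) in uniformity. x' = x \<longrightarrow> y \<in> S)"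

instance
proof
  fix x y z :: "'a ell2" and r :: real and S :: "'a ell2 set"
  show "dist x y = norm (x - y)" "sgn x = x /\<^sub>R norm x"
    by (simp_all add: dist_ell2_def sgn_ell2_def)
  show "uniformity = (INF e\<in>{0<..}. principal {(x, y). dist (x::'a ell2) y < e})"
    by (rule uniformity_ell2_def)
  show "open S = (\<forall>x\<in>S. \<forall>\<^sub>F (x', y) in uniformity. x' = x \<longrightarrow> y \<in> S)"
    by (rule open_ell2_def)
  show "inner x y = inner y x"
    unfolding inner_ell2_def by (subst cinner_commute) simp
  show "inner (x + y) z = inner x z + inner y z"
    by (simp add: inner_ell2_def cinner_add_left)
  show "inner (r *\<^sub>R x) y = r * inner x y"
    by (simp add: inner_ell2_def scaleR_scaleC cinner_scaleC_left)
  show "0 \<le> inner x x"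
    by (simp add: inner_ell2_def cinner_self infsum_nonneg)
  show "inner x x = 0 \<longleftrightarrow> x = 0"
  proof
    assume "inner x x = 0"
    then have "(\<Sum>\<^sub>\<infinity>i. (cmod (ell2_apply x i))\<^sup>2) \<le> 0"
      by (simp add: inner_ell2_def cinner_self)
    then have "(cmod (ell2_apply x i))\<^sup>2 = 0" for i
      using ell2_apply_square_summable[of x] unfolding square_summable_def
      by (rule nonneg_infsum_le_0D) auto
    then show "x = 0"
      by transfer auto
  next
    assume "x = 0"
    then show "inner x x = 0"
      by (simp add: inner_ell2_def cinner_self zero_ell2.rep_eq)
  qed
  show "norm x = sqrt (inner x x)"
    by (simp add: inner_ell2_def norm_ell2_def cinner_self)
qed

end

lemma L2_set_le_norm: "finite F \<Longrightarrow> L2_set (\<lambda>i. cmod (ell2_apply x i)) F \<le> norm x"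
  unfolding norm_ell2_def by (rule L2_set_le_infsum[OF ell2_apply_square_summable])

lemma norm_ell2_leI:
  assumes "\<And>F. finite F \<Longrightarrow> L2_set (\<lambda>i. cmod (ell2_apply x i)) F \<le> B"
  shows "norm x \<le> B"
proof -
  have "0 \<le> B"
    using assms[of "{}"] by simp
  have "(\<Sum>i\<in>F. (cmod (ell2_apply x i))\<^sup>2) \<le> B\<^sup>2" if "finite F" for F
    using assms[OF that] unfolding L2_set_def
    by (metis real_sqrt_ge_zero real_sqrt_pow2 sum_nonneg power_mono zero_le_power2)
  then have "(\<Sum>\<^sub>\<infinity>i. (cmod (ell2_apply x i))\<^sup>2) \<le> B\<^sup>2"
    using ell2_apply_square_summable[of x] unfolding square_summable_def
    by (intro infsum_le_finite_sums) auto
  then show ?thesis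
    unfolding norm_ell2_def using \<open>0 \<le> B\<close> by (simp add: real_le_lsqrt)
qed

lemma cmod_ell2_apply_le: "cmod (ell2_apply x i) \<le> norm x"
  using L2_set_le_norm[of "{i}" x] by simp

lemma norm_scaleC_ell2: "norm (c *\<^sub>C (x::'i ell2)) = cmod c * norm x"
  unfolding norm_ell2_def scaleC_ell2.rep_eq
  by (simp add: norm_mult power_mult_distrib infsum_cmult_right' real_sqrt_mult)

instance ell2 :: (type) banach
proof
  fix X :: "nat \<Rightarrow> 'a ell2"
  assume X: "Cauchy X"
  have "Cauchy (\<lambda>n. ell2_apply (X n) i)" for i
  proof (rule CauchyI)
    fix e :: real assume "0 < e"
    then obtain M where M: "\<And>m n. m \<ge> M \<Longrightarrow> n \<ge> M \<Longrightarrow> norm (X m - X n) < e"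
      using CauchyD[OF X] by blast
    have "norm (ell2_apply (X m) i - ell2_apply (X n) i) < e" if "m \<ge> M" "n \<ge> M" for m n
      using cmod_ell2_apply_le[of "X m - X n" i] M[OF that] by (simp add: minus_ell2.rep_eq)
    then show "\<exists>M. \<forall>m\<ge>M. \<forall>n\<ge>M. norm (ell2_apply (X m) i - ell2_apply (X n) i) < e"
      by blast
  qed
  then have "\<forall>i. \<exists>l. (\<lambda>n. ell2_apply (X n) i) \<longlonglongrightarrow> l"
    using Cauchy_convergent convergent_def by blast
  then obtain g where g: "\<And>i. (\<lambda>n. ell2_apply (X n) i) \<longlonglongrightarrow> g i"
    by metis
  have tail: "L2_set (\<lambda>i. cmod (ell2_apply (X n) i - g i)) F \<le> e"
    if F: "finite F" and M: "\<And>m. m \<ge> M \<Longrightarrow> norm (X n - X m) \<le> e" for n M e F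
  proof (rule LIMSEQ_le_const2)
    show "(\<lambda>m. L2_set (\<lambda>i. cmod (ell2_apply (X n) i - ell2_apply (X m) i)) F)
        \<longlonglongrightarrow> L2_set (\<lambda>i. cmod (ell2_apply (X n) i - g i)) F"
      unfolding L2_set_def by (intro tendsto_intros g)
    have "L2_set (\<lambda>i. cmod (ell2_apply (X n) i - ell2_apply (X m) i)) F \<le> e" if "m \<ge> M" for m
      using L2_set_le_norm[OF F, of "X n - X m"] M[OF that] by (simp add: minus_ell2.rep_eq)
    then show "\<exists>N. \<forall>m\<ge>N. L2_set (\<lambda>i. cmod (ell2_apply (X n) i - ell2_apply (X m) i)) F \<le> e"
      by blast
  qed
  have tail_ev: "\<exists>M. \<forall>n\<ge>M. \<forall>F. finite F \<longrightarrow> L2_set (\<lambda>i. cmod (ell2_apply (X n) i - g i)) F \<le> e"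
    if "e > 0" for e
    using CauchyD[OF X that] by (metis tail less_imp_le)
  obtain M where "\<And>F. finite F \<Longrightarrow> L2_set (\<lambda>i. cmod (ell2_apply (X M) i - g i)) F \<le> 1"
    using tail_ev[of 1] by auto
  then have "square_summable (\<lambda>i. ell2_apply (X M) i - g i)"
    by (rule square_summableI)
  from square_summable_add[OF ell2_apply_square_summable[of "X M"] square_summable_scale[OF this, of "-1"]]
  have gs: "square_summable g"
    by simp
  define L where "L = Abs_ell2 g"
  have L: "ell2_apply L = g"
    unfolding L_def using gs by (simp add: Abs_ell2_inverse)
  have "X \<longlonglongrightarrow> L"
  proof (rule LIMSEQ_I)
    fix r :: real assume r: "0 < r"
    then obtain M where M: "\<And>n F. n \<ge> M \<Longrightarrow> finite F \<Longrightarrow>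
        L2_set (\<lambda>i. cmod (ell2_apply (X n) i - g i)) F \<le> r / 2"
      using tail_ev[of "r / 2"] by auto
    have "norm (X n - L) < r" if "n \<ge> M" for n
    proof -
      have "norm (X n - L) \<le> r / 2"
        by (rule norm_ell2_leI) (simp only: minus_ell2.rep_eq L M that)
      then show ?thesis using r by linarith
    qed
    then show "\<exists>no. \<forall>n\<ge>no. norm (X n - L) < r" by blast
  qed
  then show "convergent X"
    by (rule convergentI)
qed

lift_definition ket :: "'i \<Rightarrow> 'i ell2" is "\<lambda>i j. if j = i then 1 else 0"
proof -
  fix i :: 'i
  have "(\<lambda>j. (cmod (if j = i then 1 else 0))\<^sup>2) summable_on UNIV \<longleftrightarrow>
      (\<lambda>j. 1 :: real) summable_on {i}"
    by (rule summable_on_cong_neutral) auto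
  then show "square_summable (\<lambda>j. if j = i then 1 else 0)"
    by (simp add: square_summable_def)
qed

lemma norm_ket [simp]: "norm (ket i) = 1"
proof -
  have "(\<Sum>\<^sub>\<infinity>j. (cmod (if j = i then 1 else 0))\<^sup>2) = (\<Sum>\<^sub>\<infinity>j\<in>{i}. (1::real))"
    by (rule infsum_cong_neutral) auto
  then show ?thesis
    unfolding norm_ell2_def ket.rep_eq by simp
qed

lemma cinner_ket: "cinner (ket i) x = ell2_apply x i"
proof -
  have "(\<Sum>\<^sub>\<infinity>j. cnj (if j = i then 1 else 0) * ell2_apply x j) = (\<Sum>\<^sub>\<infinity>j\<in>{i}. ell2_apply x j)"
    by (rule infsum_cong_neutral) auto
  then show ?thesis
    unfolding cinner.rep_eq ket.rep_eq by simp
qed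


section \<open>Bounded operators\<close>

typedef 'i bop = "{T :: 'i ell2 \<Rightarrow>\<^sub>L 'i ell2. \<forall>c x. T (c *\<^sub>C x) = c *\<^sub>C T x}"
  morphisms blinfun_of_bop Abs_bop
  by (rule exI[of _ id_blinfun]) simp

setup_lifting type_definition_bop

abbreviation bop_apply :: "'i bop \<Rightarrow> 'i ell2 \<Rightarrow> 'i ell2"  (infixr \<open>\<cdot>\<close> 80) where
  "T \<cdot> x \<equiv> blinfun_apply (blinfun_of_bop T) x"

lemma bop_scaleC: "T \<cdot> (c *\<^sub>C x) = c *\<^sub>C (T \<cdot> x)"
  using blinfun_of_bop by blast

lemma bop_eqI: "(\<And>x. S \<cdot> x = T \<cdot> x) \<Longrightarrow> S = T"
  by (metis blinfun_eqI blinfun_of_bop_inject)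

definition scaleC_blinfun :: "complex \<Rightarrow> ('i ell2 \<Rightarrow>\<^sub>L 'i ell2) \<Rightarrow> ('i ell2 \<Rightarrow>\<^sub>L 'i ell2)" where
  "scaleC_blinfun c T = Blinfun (\<lambda>x. c *\<^sub>C T x)"

lemma scaleC_blinfun_apply: "scaleC_blinfun c T x = c *\<^sub>C T x"
proof -
  have "bounded_linear (\<lambda>x. c *\<^sub>C T x)"
  proof (rule bounded_linear_intro)
    show "norm (c *\<^sub>C T x) \<le> norm x * (cmod c * norm T)" for x
      using mult_left_mono[OF norm_blinfun[of T x], of "cmod c"]
      by (simp add: norm_scaleC_ell2 ac_simps)
  qed (simp_all add: blinfun.add_right blinfun.scaleR_right scaleC_add_right scaleC_scaleR)
  then show ?thesis
    by (simp add: scaleC_blinfun_def bounded_linear_Blinfun_apply)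
qed

instantiation bop :: (type) complex_vector
begin

lift_definition zero_bop :: "'a bop" is 0
  by simp
lift_definition plus_bop :: "'a bop \<Rightarrow> 'a bop \<Rightarrow> 'a bop" is "(+)"
  by (simp add: blinfun.add_left scaleC_add_right)
lift_definition uminus_bop :: "'a bop \<Rightarrow> 'a bop" is uminus
  by (simp add: blinfun.minus_left) (transfer, simp)
lift_definition minus_bop :: "'a bop \<Rightarrow> 'a bop \<Rightarrow> 'a bop" is "(-)"
  by (simp add: blinfun.diff_left) (transfer, simp add: right_diff_distrib)
lift_definition scaleR_bop :: "real \<Rightarrow> 'a bop \<Rightarrow> 'a bop" is scaleR
  by (simp add: blinfun.scaleR_left scaleR_scaleC scaleC_scaleC mult.commute)
lift_definition scaleC_bop :: "complex \<Rightarrow> 'a bop \<Rightarrow> 'a bop" is scaleC_blinfun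
  by (simp add: scaleC_blinfun_apply scaleC_scaleC mult.commute)

instance
proof
  fix a b c :: "'a bop" and r s :: real and z w :: complex
  show "a + b + c = a + (b + c)" "a + b = b + a" "0 + a = a" "- a + a = 0" "a - b = a + - b"
    by (transfer, simp)+
  show "r *\<^sub>R (a + b) = r *\<^sub>R a + r *\<^sub>R b" "(r + s) *\<^sub>R a = r *\<^sub>R a + s *\<^sub>R a"
    "r *\<^sub>R s *\<^sub>R a = (r * s) *\<^sub>R a" "1 *\<^sub>R a = a"
    by (transfer, simp add: scaleR_add_right scaleR_add_left)+
  show "z *\<^sub>C (a + b) = z *\<^sub>C a + z *\<^sub>C b" "(z + w) *\<^sub>C a = z *\<^sub>C a + w *\<^sub>C a"
    "z *\<^sub>C w *\<^sub>C a = (z * w) *\<^sub>C a" "1 *\<^sub>C a = a" "r *\<^sub>R a = complex_of_real r *\<^sub>C a"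
    by (transfer, rule blinfun_eqI,
        simp add: scaleC_blinfun_apply blinfun.add_left blinfun.scaleR_left scaleC_add_right
          scaleC_add_left scaleC_scaleC scaleC_one scaleR_scaleC)+
qed

end

instantiation bop :: (type) real_normed_algebra_1
begin

lift_definition one_bop :: "'a bop" is id_blinfun by simp
lift_definition times_bop :: "'a bop \<Rightarrow> 'a bop \<Rightarrow> 'a bop" is "(o\<^sub>L)"
  by simp
lift_definition norm_bop :: "'a bop \<Rightarrow> real" is norm .

definition dist_bop :: "'a bop \<Rightarrow> 'a bop \<Rightarrow> real" where
  "dist_bop S T = norm (S - T)"
definition sgn_bop :: "'a bop \<Rightarrow> 'a bop" where
  "sgn_bop T = T /\<^sub>R norm T"
definition uniformity_bop :: "('a bop \<times> 'a bop) filter" where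
  "uniformity_bop = (INF e\<in>{0<..}. principal {(S, T). dist S T < e})"
definition open_bop :: "'a bop set \<Rightarrow> bool" where
  "open_bop U = (\<forall>S\<in>U. \<forall>\<^sub>F (S', T) in uniformity. S' = S \<longrightarrow> T \<in> U)"

instance
proof
  fix a b c :: "'a bop" and r :: real and U :: "'a bop set"
  show "a * b * c = a * (b * c)" "1 * a = a" "a * 1 = a"
    by (transfer, rule blinfun_eqI, simp)+
  show "(a + b) * c = a * c + b * c" "a * (b + c) = a * b + a * c"
    by (transfer, rule blinfun_eqI, simp add: blinfun.add_left blinfun.add_right)+
  show "r *\<^sub>R a * b = r *\<^sub>R (a * b)" "a * r *\<^sub>R b = r *\<^sub>R (a * b)"
    by (transfer, rule blinfun_eqI, simp add: blinfun.scaleR_left blinfun.scaleR_right)+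
  show "dist a b = norm (a - b)" "sgn a = a /\<^sub>R norm a"
    by (simp_all add: dist_bop_def sgn_bop_def)
  show "uniformity = (INF e\<in>{0<..}. principal {(S, T). dist (S::'a bop) T < e})"
    by (rule uniformity_bop_def)
  show "open U = (\<forall>S\<in>U. \<forall>\<^sub>F (S', T) in uniformity. S' = S \<longrightarrow> T \<in> U)"
    by (rule open_bop_def)
  show "norm a = 0 \<longleftrightarrow> a = 0" "norm (a + b) \<le> norm a + norm b" "norm (r *\<^sub>R a) = \<bar>r\<bar> * norm a"
    by (transfer, simp add: norm_triangle_ineq)+
  show "norm (a * b) \<le> norm a * norm b"
    by (transfer, rule norm_blinfun_compose)
  have nz: "ket i \<noteq> 0" for i :: 'a
    using norm_ket[of i] by (metis norm_zero zero_neq_one)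
  show "(0::'a bop) \<noteq> 1"
  proof (transfer, rule notI)
    assume "(0 :: 'a ell2 \<Rightarrow>\<^sub>L 'a ell2) = id_blinfun"
    then have "blinfun_apply 0 (ket i) = blinfun_apply id_blinfun (ket i)" for i :: 'a
      by (simp only:)
    then have "ket i = 0" for i :: 'a
      by simp
    with nz show False by blast
  qed
  show "norm (1::'a bop) = 1"
  proof (transfer, rule antisym)
    show "norm (id_blinfun :: 'a ell2 \<Rightarrow>\<^sub>L 'a ell2) \<le> 1"
      by (rule norm_blinfun_id_le)
    show "1 \<le> norm (id_blinfun :: 'a ell2 \<Rightarrow>\<^sub>L 'a ell2)"
      using norm_blinfun[of id_blinfun "ket undefined"] by simp
  qed
qed

end

lemma bop_simps:
  "(S + T) \<cdot> x = S \<cdot> x + T \<cdot> x" "(S - T) \<cdot> x = S \<cdot> x - T \<cdot> x" "(c *\<^sub>C T) \<cdot> x = c *\<^sub>C (T \<cdot> x)"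
  "(S * T) \<cdot> x = S \<cdot> T \<cdot> x" "0 \<cdot> x = 0" "1 \<cdot> x = x"
  by (simp_all add: plus_bop.rep_eq minus_bop.rep_eq scaleC_bop.rep_eq scaleC_blinfun_apply
      times_bop.rep_eq zero_bop.rep_eq one_bop.rep_eq blinfun.add_left blinfun.diff_left)

lemma norm_bop_apply: "norm (T \<cdot> x) \<le> norm T * norm x"
  by transfer (rule norm_blinfun)

lemma cinner_zero [simp]: "cinner x 0 = 0" "cinner 0 x = 0"
  using cinner_scaleC_right[of x 0 0] cinner_scaleC_left[of 0 0 x] by simp_all

lemma cinner_sum_right: "cinner x (\<Sum>i\<in>F. f i) = (\<Sum>i\<in>F. cinner x (f i))"
  by (induction F rule: infinite_finite_induct) (simp_all add: cinner_add_right)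

lemma cinner_sum_left: "cinner (\<Sum>i\<in>F. f i) x = (\<Sum>i\<in>F. cinner (f i) x)"
  by (induction F rule: infinite_finite_induct) (simp_all add: cinner_add_left)

lemma cinner_norm: "cinner x x = complex_of_real ((norm x)\<^sup>2)"
  by (simp add: cinner_self norm_ell2_def infsum_nonneg)

lemma ell2_eqI: "(\<And>i. ell2_apply x i = ell2_apply y i) \<Longrightarrow> x = y"
  by transfer auto

lemma ell2_apply_sum_ket:
  assumes "finite F"
  shows "ell2_apply (\<Sum>i\<in>F. c i *\<^sub>C ket i) j = (if j \<in> F then c j else 0)"
proof -
  have "ell2_apply (\<Sum>i\<in>F. c i *\<^sub>C ket i) j = (\<Sum>i\<in>F. c i * ell2_apply (ket i) j)"
    by (simp flip: cinner_ket add: cinner_sum_right cinner_scaleC_right)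
  also have "\<dots> = (\<Sum>i\<in>F. if j = i then c i else 0)"
    by (intro sum.cong) (auto simp: ket.rep_eq)
  finally show ?thesis
    using assms by simp
qed

lemma norm_sum_ket:
  assumes "finite F"
  shows "norm (\<Sum>i\<in>F. c i *\<^sub>C ket i) = L2_set (\<lambda>i. cmod (c i)) F"
proof -
  have "(\<Sum>\<^sub>\<infinity>i. (cmod (ell2_apply (\<Sum>i\<in>F. c i *\<^sub>C ket i) i))\<^sup>2) = (\<Sum>\<^sub>\<infinity>i\<in>F. (cmod (c i))\<^sup>2)"
    using assms by (intro infsum_cong_neutral) (auto simp: ell2_apply_sum_ket)
  then show ?thesis
    using assms by (simp add: norm_ell2_def L2_set_def)
qed

lemma has_sum_ket: "((\<lambda>i. ell2_apply x i *\<^sub>C ket i) has_sum x) UNIV"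
proof -
  let ?s = "\<lambda>F. \<Sum>i\<in>F. ell2_apply x i *\<^sub>C ket i"
  let ?n = "\<lambda>F. \<Sum>i\<in>F. (cmod (ell2_apply x i))\<^sup>2"
  have nx: "(norm x)\<^sup>2 = (\<Sum>\<^sub>\<infinity>i. (cmod (ell2_apply x i))\<^sup>2)"
    by (simp add: norm_ell2_def infsum_nonneg)
  have *: "(norm (?s F - x))\<^sup>2 = (norm x)\<^sup>2 - ?n F" if F: "finite F" for F
  proof -
    have "(norm (?s F - x))\<^sup>2 = (norm (?s F))\<^sup>2 - 2 * inner (?s F) x + (norm x)\<^sup>2"
      by (simp add: power2_norm_eq_inner inner_diff_left inner_diff_right inner_commute)
    moreover have "cinner (?s F) x = (\<Sum>i\<in>F. complex_of_real ((cmod (ell2_apply x i))\<^sup>2))"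
      by (simp only: cinner_sum_left cinner_scaleC_left cinner_ket complex_norm_square mult.commute)
    then have "inner (?s F) x = ?n F"
      by (simp add: inner_ell2_def)
    moreover have "(norm (?s F))\<^sup>2 = ?n F"
      using F by (simp add: norm_sum_ket L2_set_def sum_nonneg)
    ultimately show ?thesis by simp
  qed
  have "(?n \<longlongrightarrow> (norm x)\<^sup>2) (finite_subsets_at_top UNIV)"
    using has_sum_infsum[of "\<lambda>i. (cmod (ell2_apply x i))\<^sup>2" UNIV] ell2_apply_square_summable[of x]
    by (simp add: nx square_summable_def has_sum_def)
  then have "((\<lambda>F. (norm x)\<^sup>2 - ?n F) \<longlongrightarrow> (norm x)\<^sup>2 - (norm x)\<^sup>2) (finite_subsets_at_top UNIV)"
    by (intro tendsto_diff tendsto_const)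
  then have "((\<lambda>F. (norm (?s F - x))\<^sup>2) \<longlongrightarrow> 0) (finite_subsets_at_top UNIV)"
    by (rule Lim_transform_eventually[THEN tendsto_eq_rhs])
      (auto simp: * intro!: eventually_finite_subsets_at_top_weakI)
  then have "((\<lambda>F. sqrt ((norm (?s F - x))\<^sup>2)) \<longlongrightarrow> sqrt 0) (finite_subsets_at_top UNIV)"
    by (rule tendsto_real_sqrt)
  then have "((\<lambda>F. norm (?s F - x)) \<longlongrightarrow> 0) (finite_subsets_at_top UNIV)"
    by simp
  then show ?thesis
    unfolding has_sum_def by (simp only: tendsto_norm_zero_iff LIM_zero_iff)
qed

lemma bounded_linear_eq_on_ket:
  fixes f g :: "'i ell2 \<Rightarrow> 'b::real_normed_vector"
  assumes "bounded_linear f" "bounded_linear g"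
    and "\<And>c i. f (c *\<^sub>C ket i) = g (c *\<^sub>C ket i)"
  shows "f x = g x"
proof -
  have "((\<lambda>i. f (ell2_apply x i *\<^sub>C ket i)) has_sum f x) UNIV"
    "((\<lambda>i. g (ell2_apply x i *\<^sub>C ket i)) has_sum g x) UNIV"
    using has_sum_bounded_linear[OF assms(1) has_sum_ket[of x]]
      has_sum_bounded_linear[OF assms(2) has_sum_ket[of x]] by (simp_all add: comp_def)
  then show ?thesis
    using assms(3) has_sum_unique by fastforce
qed

lemma bop_eq_on_ket:
  assumes "\<And>i. S \<cdot> ket i = T \<cdot> ket i"
  shows "S = T"
  by (rule bop_eqI, rule bounded_linear_eq_on_ket)
    (simp_all add: bop_scaleC assms blinfun.bounded_linear_right)

lemma bop_construct:
  assumes "\<And>x y. f (x + y) = f x + f y" "\<And>c x. f (c *\<^sub>C x) = c *\<^sub>C f x"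
    and "\<And>x. norm (f x) \<le> norm x * K"
  shows "\<exists>T. \<forall>x. T \<cdot> x = f x"
proof -
  have "bounded_linear f"
    by (rule bounded_linear_intro[of f K]) (simp_all add: assms scaleR_scaleC)
  then show ?thesis
    by (intro exI[of _ "Abs_bop (Blinfun f)"])
      (simp add: Abs_bop_inverse bounded_linear_Blinfun_apply assms)
qed

lemma cmod_cinner_le: "cmod (cinner x y) \<le> norm x * norm y"
proof (cases "cinner x y = 0")
  case False
  define c where "c = cnj (cinner x y) / cmod (cinner x y)"
  have c: "cmod c = 1"
    using False by (simp add: c_def norm_divide)
  have "cinner x (c *\<^sub>C y) = cmod (cinner x y)"
    using False by (simp add: c_def cinner_scaleC_right complex_norm_square[symmetric]
        mult.commute power2_eq_square)
  then have "cmod (cinner x y) = inner x (c *\<^sub>C y)"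
    by (simp add: inner_ell2_def)
  also have "\<dots> \<le> norm x * norm (c *\<^sub>C y)"
    by (rule norm_cauchy_schwarz)
  finally show ?thesis
    by (simp add: norm_scaleC_ell2 c)
qed simp

lemma bounded_linear_cinner_right: "bounded_linear (cinner x)"
proof (rule bounded_linear_intro[of _ "norm x"])
  show "cmod (cinner x y) \<le> norm y * norm x" for y
    using cmod_cinner_le[of x y] by (simp only: mult.commute)
qed (simp_all add: cinner_add_right scaleR_scaleC cinner_scaleC_right scaleR_conv_of_real)

definition adj :: "'i bop \<Rightarrow> 'i bop" where
  "adj T = (THE S. \<forall>x y. cinner (S \<cdot> x) y = cinner x (T \<cdot> y))"

lemma adj_unique:
  assumes "\<And>x y. cinner (S \<cdot> x) y = cinner (S' \<cdot> x) y"
  shows "S = S'"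
proof (rule bop_eqI, rule ell2_eqI)
  fix x i
  have "cinner (ket i) (S \<cdot> x) = cinner (ket i) (S' \<cdot> x)"
    using assms[of x "ket i"] by (metis cinner_commute)
  then show "ell2_apply (S \<cdot> x) i = ell2_apply (S' \<cdot> x) i"
    by (simp add: cinner_ket)
qed

lemma adj_exists: "\<exists>S. \<forall>x y. cinner (S \<cdot> x) y = cinner x (T \<cdot> y)"
proof -
  let ?g = "\<lambda>x i. cinner (T \<cdot> ket i) x"
  have bound: "L2_set (\<lambda>i. cmod (?g x i)) F \<le> norm x * norm T" if F: "finite F" for x F
  proof -
    let ?v = "\<Sum>i\<in>F. ?g x i *\<^sub>C ket i"
    let ?s = "L2_set (\<lambda>i. cmod (?g x i)) F"
    have "T \<cdot> ?v = (\<Sum>i\<in>F. ?g x i *\<^sub>C (T \<cdot> ket i))"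
      by (simp add: blinfun.sum_right bop_scaleC)
    then have "cinner (T \<cdot> ?v) x = (\<Sum>i\<in>F. cnj (?g x i) * ?g x i)"
      by (simp add: cinner_sum_left cinner_scaleC_left)
    also have "\<dots> = (\<Sum>i\<in>F. complex_of_real ((cmod (?g x i))\<^sup>2))"
      by (intro sum.cong refl) (simp only: complex_norm_square mult.commute)
    finally have "?s\<^sup>2 = inner (T \<cdot> ?v) x"
      by (simp add: inner_ell2_def L2_set_def sum_nonneg)
    also have "inner (T \<cdot> ?v) x \<le> norm (T \<cdot> ?v) * norm x"
      by (rule norm_cauchy_schwarz)
    also have "\<dots> \<le> norm T * ?s * norm x"
      using norm_bop_apply[of T ?v] F by (intro mult_right_mono) (simp_all add: norm_sum_ket)
    finally have "?s * ?s \<le> ?s * (norm x * norm T)"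
      by (simp add: power2_eq_square ac_simps)
    then show ?thesis
      using L2_set_nonneg[of "\<lambda>i. cmod (?g x i)" F]
      by (cases "?s = 0") (auto simp: mult_le_cancel_left)
  qed
  define f where "f x = Abs_ell2 (?g x)" for x
  have g: "ell2_apply (f x) i = ?g x i" for x i
    unfolding f_def using square_summableI[of "?g x", OF bound] by (simp add: Abs_ell2_inverse)
  obtain S where S: "\<And>x. S \<cdot> x = f x"
  proof -
    have "\<exists>S. \<forall>x. S \<cdot> x = f x"
    proof (rule bop_construct)
      show "norm (f x) \<le> norm x * norm T" for x
        by (rule norm_ell2_leI) (simp only: g bound)
    qed (rule ell2_eqI; simp add: g plus_ell2.rep_eq scaleC_ell2.rep_eq cinner_add_right
        cinner_scaleC_right)+
    then show ?thesis using that by blast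
  qed
  have "cinner (S \<cdot> x) y = cinner x (T \<cdot> y)" for x y
  proof (rule bounded_linear_eq_on_ket[where f = "cinner (S \<cdot> x)" and g = "\<lambda>y. cinner x (T \<cdot> y)"])
    show "bounded_linear (\<lambda>y. cinner x (T \<cdot> y))"
      by (intro bounded_linear_compose[OF bounded_linear_cinner_right]
          blinfun.bounded_linear_right)
    show "cinner (S \<cdot> x) (c *\<^sub>C ket i) = cinner x (T \<cdot> (c *\<^sub>C ket i))" for c i
    proof -
      have "cinner (S \<cdot> x) (ket i) = cnj (ell2_apply (S \<cdot> x) i)"
        by (metis cinner_commute cinner_ket)
      also have "\<dots> = cinner x (T \<cdot> ket i)"
        unfolding S g by (metis cinner_commute)
      finally show ?thesis
        by (simp add: bop_scaleC cinner_scaleC_right)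
    qed
  qed (rule bounded_linear_cinner_right)
  then show ?thesis by blast
qed

lemma cinner_adj: "cinner (adj T \<cdot> x) y = cinner x (T \<cdot> y)"
proof -
  have "\<exists>!S. \<forall>x y. cinner (S \<cdot> x) y = cinner x (T \<cdot> y)"
  proof (rule ex_ex1I[OF adj_exists])
    fix S S'
    assume "\<forall>x y. cinner (S \<cdot> x) y = cinner x (T \<cdot> y)" "\<forall>x y. cinner (S' \<cdot> x) y = cinner x (T \<cdot> y)"
    then show "S = S'" by (intro adj_unique) simp
  qed
  from theI'[OF this] show ?thesis
    unfolding adj_def by blast
qed

definition basis_op :: "('i \<Rightarrow> 'i ell2) \<Rightarrow> 'i bop" where
  "basis_op v = (THE T. \<forall>i. T \<cdot> ket i = v i)"

lemma basis_op_partial_inj: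
  assumes inj: "inj_on h D"
  shows "basis_op (\<lambda>i. if i \<in> D then ket (h i) else 0) \<cdot> ket j = (if j \<in> D then ket (h j) else 0)"
proof -
  let ?v = "\<lambda>i. if i \<in> D then ket (h i) else 0"
  let ?f = "\<lambda>x w. if w \<in> h ` D then ell2_apply x (inv_into D h w) else 0"
  have bound: "L2_set (\<lambda>w. cmod (?f x w)) F \<le> norm x * 1" if F: "finite F" for x F
  proof -
    have "(\<Sum>w\<in>F. (cmod (?f x w))\<^sup>2) = (\<Sum>w\<in>F \<inter> h ` D. (cmod (ell2_apply x (inv_into D h w)))\<^sup>2)"
      using F by (intro sum.mono_neutral_cong_right) auto
    also have "\<dots> = (\<Sum>i\<in>inv_into D h ` (F \<inter> h ` D). (cmod (ell2_apply x i))\<^sup>2)"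
      by (subst sum.reindex) (auto intro: inj_on_subset[OF inj_on_inv_into])
    finally have "L2_set (\<lambda>w. cmod (?f x w)) F
        = L2_set (\<lambda>i. cmod (ell2_apply x i)) (inv_into D h ` (F \<inter> h ` D))"
      by (simp add: L2_set_def)
    then show ?thesis
      using L2_set_le_norm[of "inv_into D h ` (F \<inter> h ` D)" x] F by simp
  qed
  define g where "g x = Abs_ell2 (?f x)" for x
  have g: "ell2_apply (g x) w = ?f x w" for x w
    unfolding g_def using square_summableI[of "?f x", OF bound] by (simp add: Abs_ell2_inverse)
  obtain T where T: "\<And>x. T \<cdot> x = g x"
  proof -
    have "\<exists>S. \<forall>x. S \<cdot> x = g x"
    proof (rule bop_construct)
      show "norm (g x) \<le> norm x * 1" for x
        by (rule norm_ell2_leI) (simp only: g bound)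
    qed (rule ell2_eqI; simp add: g plus_ell2.rep_eq scaleC_ell2.rep_eq)+
    then show ?thesis using that by blast
  qed
  have ket: "T \<cdot> ket i = ?v i" for i
  proof (rule ell2_eqI)
    fix w
    show "ell2_apply (T \<cdot> ket i) w = ell2_apply (?v i) w"
      unfolding T g using inj by (auto simp: ket.rep_eq zero_ell2.rep_eq)
  qed
  have "\<exists>!T. \<forall>i. T \<cdot> ket i = ?v i"
    by (rule ex1I[of _ T]) (auto simp: ket intro!: bop_eq_on_ket)
  from theI'[OF this] show ?thesis
    unfolding basis_op_def by blast
qed


section \<open>Norm-closed operator algebras\<close>

definition closed_algebra :: "'i bop set \<Rightarrow> bool" where
  "closed_algebra S \<longleftrightarrow> csubspace S \<and> (\<forall>x\<in>S. \<forall>y\<in>S. x * y \<in> S) \<and> closed S"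

definition cstar_algebra :: "'i bop set \<Rightarrow> bool" where
  "cstar_algebra S \<longleftrightarrow> closed_algebra S \<and> (\<forall>x\<in>S. adj x \<in> S)"

definition mult_on :: "'i bop set \<Rightarrow> ('i bop \<Rightarrow> 'j bop) \<Rightarrow> bool" where
  "mult_on S f \<longleftrightarrow> (\<forall>x\<in>S. \<forall>y\<in>S. f (x * y) = f x * f y)"

definition alg_hom_on :: "'i bop set \<Rightarrow> ('i bop \<Rightarrow> 'j bop) \<Rightarrow> bool" where
  "alg_hom_on S f \<longleftrightarrow> clinear_on S f \<and> mult_on S f"

definition star_hom_on :: "'i bop set \<Rightarrow> ('i bop \<Rightarrow> 'j bop) \<Rightarrow> bool" where
  "star_hom_on S f \<longleftrightarrow> alg_hom_on S f \<and> (\<forall>x\<in>S. f (adj x) = adj (f x))"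

text \<open>The norm of an \<open>n \<times> n\<close> matrix of operators on \<open>H\<close> is its operator norm on the
  Hilbert space direct sum of \<open>n\<close> copies of \<open>H\<close>.\<close>

definition matrix_norm :: "nat \<Rightarrow> (nat \<Rightarrow> nat \<Rightarrow> 'i bop) \<Rightarrow> real" where
  "matrix_norm n x =
     (SUP h\<in>{h. L2_set (\<lambda>j. norm (h j)) {..<n} \<le> 1}.
        L2_set (\<lambda>i. norm (\<Sum>j<n. x i j \<cdot> h j)) {..<n})"

definition completely_isometric_on :: "'i bop set \<Rightarrow> ('i bop \<Rightarrow> 'j bop) \<Rightarrow> bool" where
  "completely_isometric_on S f \<longleftrightarrow>
     (\<forall>n x. (\<forall>i<n. \<forall>j<n. x i j \<in> S) \<longrightarrow> matrix_norm n (\<lambda>i j. f (x i j)) = matrix_norm n x)"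


section \<open>Monomial ideals in noncommuting variables\<close>

text \<open>Words form the free monoid, written additively because \<open>Poly_Mapping\<close> multiplies
  by convolution over an additive monoid. Thus \<open>'d list \<Rightarrow>\<^sub>0 complex\<close> is the ring of polynomials
  in noncommuting variables indexed by \<open>'d\<close>.\<close>

instantiation list :: (type) monoid_add
begin

definition zero_list :: "'a list" where "0 = []"
definition plus_list :: "'a list \<Rightarrow> 'a list \<Rightarrow> 'a list" where "xs + ys = xs @ ys"

instance
  by standard (simp_all add: zero_list_def plus_list_def)

end

type_synonym 'd ncpoly = "'d list \<Rightarrow>\<^sub>0 complex"

definition ncvar :: "'d \<Rightarrow> 'd ncpoly" where
  "ncvar i = Poly_Mapping.single [i] 1"

definition ncmonomial :: "'d list \<Rightarrow> 'd ncpoly" where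
  "ncmonomial \<mu> = prod_list (map ncvar \<mu>)"

lemma ncmonomial_eq_single: "ncmonomial \<mu> = Poly_Mapping.single \<mu> 1"
proof (induction \<mu>)
  case Nil
  then show ?case
    by (simp add: ncmonomial_def zero_list_def flip: single_one)
next
  case (Cons i \<mu>)
  then show ?case
    by (simp add: ncmonomial_def ncvar_def mult_single plus_list_def)
qed

definition two_sided_ideal :: "'r::ring_1 set \<Rightarrow> bool" where
  "two_sided_ideal J \<longleftrightarrow>
     0 \<in> J \<and> (\<forall>x\<in>J. \<forall>y\<in>J. x + y \<in> J) \<and> (\<forall>r. \<forall>x\<in>J. r * x \<in> J \<and> x * r \<in> J)"

definition monomial_ideal :: "'d ncpoly set \<Rightarrow> bool" where
  "monomial_ideal J \<longleftrightarrow>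
     (\<exists>M. (\<forall>\<mu>\<in>M. 2 \<le> length \<mu>) \<and> J = two_sided_ideal hull (ncmonomial ` M))"

definition allowed_words :: "'d ncpoly set \<Rightarrow> 'd list set" where
  "allowed_words J = {\<mu>. ncmonomial \<mu> \<notin> J}"


section \<open>The tensor algebra of the subproduct system\<close>

text \<open>The Fock space of \<open>J\<close> is realised as the closed linear span of the \<open>ket \<mu>\<close>, \<open>\<mu>\<close> an allowed
  word, inside \<open>'d list ell2\<close>. An operator on it is identified with its extension by zero on the
  orthogonal complement, which preserves sums, products, adjoints and matrix norms; the identity
  of the Fock space becomes the projection \<open>fock_one J\<close>.\<close>

definition fock_one :: "'d ncpoly set \<Rightarrow> 'd list bop" where
  "fock_one J = basis_op (\<lambda>\<nu>. if \<nu> \<in> allowed_words J then ket \<nu> else 0)"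

definition creation :: "'d ncpoly set \<Rightarrow> 'd \<Rightarrow> 'd list bop" where
  "creation J i =
     basis_op (\<lambda>\<nu>. if \<nu> \<in> allowed_words J \<and> i # \<nu> \<in> allowed_words J then ket (i # \<nu>) else 0)"

lemma fock_one_ket: "fock_one J \<cdot> ket \<nu> = (if \<nu> \<in> allowed_words J then ket \<nu> else 0)"
  unfolding fock_one_def
  using basis_op_partial_inj[of "\<lambda>\<nu>. \<nu>" "allowed_words J" \<nu>] by simp

lemma creation_ket:
  "creation J i \<cdot> ket \<nu> =
     (if \<nu> \<in> allowed_words J \<and> i # \<nu> \<in> allowed_words J then ket (i # \<nu>) else 0)"
  unfolding creation_def
  using basis_op_partial_inj[of "(#) i" "{\<nu>. \<nu> \<in> allowed_words J \<and> i # \<nu> \<in> allowed_words J}" \<nu>]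
  by simp

primrec creation_word :: "'d ncpoly set \<Rightarrow> 'd list \<Rightarrow> 'd list bop" where
  "creation_word J [] = fock_one J"
| "creation_word J (i # \<mu>) = creation J i * creation_word J \<mu>"

definition tensor_algebra :: "'d ncpoly set \<Rightarrow> 'd list bop set" where
  "tensor_algebra J = closed_algebra hull insert (fock_one J) (range (creation J))"


section \<open>The C*-correspondence and its Toeplitz algebra\<close>

definition coeff_algebra :: "'d ncpoly set \<Rightarrow> 'd list bop set" where
  "coeff_algebra J =
     cstar_algebra hull {adj (creation_word J \<mu>) * creation_word J \<mu> | \<mu>. \<mu> \<in> allowed_words J}"

definition correspondence :: "'d ncpoly set \<Rightarrow> 'd list bop set" where
  "correspondence J = closure (csubspace hull {creation J i * a | i a. a \<in> coeff_algebra J})"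

text \<open>In the following, \<open>A\<close> is a C*-algebra of operators and \<open>E\<close> a closed space of operators that is
  a C*-correspondence over \<open>A\<close> under operator multiplication, with inner product \<open>adj \<xi> * \<eta>\<close>.\<close>

definition toeplitz_rep ::
  "'i bop set \<Rightarrow> 'i bop set \<Rightarrow> ('i bop \<Rightarrow> 'j bop) \<Rightarrow> ('i bop \<Rightarrow> 'j bop) \<Rightarrow> bool" where
  "toeplitz_rep A E \<pi> t \<longleftrightarrow>
     star_hom_on A \<pi> \<and> clinear_on E t \<and>
     (\<forall>\<xi>\<in>E. \<forall>\<eta>\<in>E. adj (t \<xi>) * t \<eta> = \<pi> (adj \<xi> * \<eta>)) \<and>
     (\<forall>a\<in>A. \<forall>\<xi>\<in>E. \<pi> a * t \<xi> = t (a * \<xi>))"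

definition toeplitz_algebra ::
  "'i bop set \<Rightarrow> 'i bop set \<Rightarrow> ('i bop \<Rightarrow> 'j bop) \<Rightarrow> ('i bop \<Rightarrow> 'j bop) \<Rightarrow> 'j bop set" where
  "toeplitz_algebra A E \<pi> t = cstar_algebra hull (\<pi> ` A \<union> t ` E)"

definition toeplitz_algebra_plus ::
  "'i bop set \<Rightarrow> 'i bop set \<Rightarrow> ('i bop \<Rightarrow> 'j bop) \<Rightarrow> ('i bop \<Rightarrow> 'j bop) \<Rightarrow> 'j bop set" where
  "toeplitz_algebra_plus A E \<pi> t = closed_algebra hull (\<pi> ` A \<union> t ` E)"

text \<open>The universal C*-algebra \<open>toeplitz_algebra A E \<pi> t\<close> is given up to isomorphism, by its universal
  property. The test representations act on \<open>'k ell2\<close>, where \<open>'k\<close> is to be an arbitrary infinite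
  index type, since HOL does not quantify over types inside a definition. For separable \<open>A\<close> and
  \<open>E\<close> the choice of infinite \<open>'k\<close> is immaterial, every pair being a direct sum of pairs on
  separable spaces.\<close>

definition universal_toeplitz_rep ::
  "'k itself \<Rightarrow> 'i bop set \<Rightarrow> 'i bop set \<Rightarrow> ('i bop \<Rightarrow> 'j bop) \<Rightarrow> ('i bop \<Rightarrow> 'j bop) \<Rightarrow> bool" where
  "universal_toeplitz_rep _ A E \<pi> t \<longleftrightarrow>
     toeplitz_rep A E \<pi> t \<and>
     (\<forall>(\<pi>' :: 'i bop \<Rightarrow> 'k bop) t'. toeplitz_rep A E \<pi>' t' \<longrightarrow>
        (\<exists>\<rho>. star_hom_on (toeplitz_algebra A E \<pi> t) \<rho> \<and>
             (\<forall>a\<in>A. \<rho> (\<pi> a) = \<pi>' a) \<and> (\<forall>\<xi>\<in>E. \<rho> (t \<xi>) = t' \<xi>)))"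

end

theory Submission
  imports Defs
begin

text \<open>
Write \<open>T\<^sub>i\<close> for the creation operators, \<open>S\<^sub>i = t(T\<^sub>i)\<close> and \<open>q = \<pi>(1)\<close>. The embedding is the
homomorphism \<open>\<phi>\<close> with \<open>\<phi>(T\<^sub>i) = S\<^sub>i\<close> and \<open>\<phi>(1) = q\<close>. Two inequalities between matrix norms are
needed.

\<^emph>\<open>\<phi> exists and is completely contractive.\<close> The
\<open>S\<^sub>i\<close> are partial isometries with orthogonal ranges, and \<open>S\<^sub>\<mu> = 0\<close> for every word \<open>\<mu>\<close> of the ideal:
since the source projections \<open>T\<^sub>\<mu>\<^sup>*T\<^sub>\<mu>\<close> can be moved through a product of generators, one has
\<open>S\<^sub>\<mu> = S\<^sub>\<mu> \<pi>(T\<^sub>\<mu>\<^sup>*T\<^sub>\<mu>)\<close> (\<open>toeplitz_word_vanish\<close>). Such a row satisfies a von Neumann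
inequality. For \<open>0 \<le> r < 1\<close> let \<open>D\<close> be the square root of \<open>1 - r\<^sup>2 \<Sum> S\<^sub>iS\<^sub>i\<^sup>*\<close>; the Poisson kernel
\<open>K h = \<Sum> e\<^sub>\<mu> \<otimes> r ^ |\<mu>| D S\<^sub>\<mu>\<^sup>* h\<close> satisfies \<open>K\<^sup>*K = q\<close> by a telescoping sum, and
\<open>K\<^sup>*(T\<^sub>i \<otimes> 1) = r S\<^sub>i K\<^sup>*\<close>. Hence \<open>x \<mapsto> K\<^sup>*(x \<otimes> 1)K\<close> is a completely contractive map that is
multiplicative on the tensor algebra and takes \<open>T\<^sub>i\<close> to \<open>r S\<^sub>i\<close> (\<open>poisson_transform\<close>). As \<open>r\<close>
tends to \<open>1\<close> these maps converge in norm on the tensor algebra, and \<open>\<phi>\<close> is their limit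
(\<open>von_Neumann_hom\<close>, \<open>toeplitz_completely_contractive_hom\<close>).

\<^emph>\<open>\<phi> does not decrease matrix norms.\<close> The inclusions of \<open>A\<close> and \<open>E\<close> into the operators on the Fock
space form a Toeplitz representation, which an injection of words into the index set \<open>'k\<close> moves
to a space with index set \<open>'k\<close>. By universality there is a star homomorphism \<open>\<rho>\<close> such that
\<open>\<rho> \<circ> \<phi>\<close> is the identity of the tensor algebra, up to that injection, and star homomorphisms of
C*-algebras are completely contractive (\<open>star_hom_completely_contractive\<close>).
\<close>

section \<open>Operators on spaces of square-summable families\<close>

lemma norm_bop_leI:
  assumes "0 \<le> B" "\<And>x. norm (T \<cdot> x) \<le> B * norm x"
  shows "norm T \<le> B"
  using assms by transfer (rule norm_blinfun_bound)

lemma bounded_linear_bop_eval: "bounded_linear (\<lambda>T. T \<cdot> x)"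
proof (rule bounded_linear_intro)
  show "norm (T \<cdot> x) \<le> norm T * norm x" for T :: "'a bop"
    by (rule norm_bop_apply)
qed (simp_all add: bop_simps scaleR_scaleC)

lemma bop_sum_apply: "(\<Sum>i\<in>F. f i) \<cdot> x = (\<Sum>i\<in>F. f i \<cdot> x)"
  by (induction F rule: infinite_finite_induct) (simp_all add: bop_simps)

lemma scaleC_minus_one: "(- 1) *\<^sub>C (x :: 'a::complex_vector) = - x"
  using scaleR_scaleC[of "- 1" x] by simp

lemma scaleC_diff_right: "c *\<^sub>C (x - y) = c *\<^sub>C x - c *\<^sub>C (y :: 'a::complex_vector)"
  using scaleC_add_right[of c "x - y" y] by simp

lemma norm_scaleC_bop: "norm (c *\<^sub>C (T :: 'i bop)) = cmod c * norm T"
proof -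
  have le: "norm (c *\<^sub>C (T :: 'i bop)) \<le> cmod c * norm T" for c T
    by (rule norm_bop_leI)
      (simp_all add: bop_simps norm_scaleC_ell2 mult.assoc mult_left_mono norm_bop_apply)
  show ?thesis
  proof (cases "c = 0")
    case False
    have "norm T = norm (inverse c *\<^sub>C c *\<^sub>C T)"
      using False by (simp add: scaleC_scaleC scaleC_one)
    also have "\<dots> \<le> cmod (inverse c) * norm (c *\<^sub>C T)"
      by (rule le)
    finally show ?thesis
      using False le[of c T] by (simp add: field_simps norm_divide)
  qed (use le[of 0 T] in simp)
qed

lemma bounded_linear_scaleC_bop: "bounded_linear (\<lambda>T :: 'i bop. c *\<^sub>C T)"
  by (rule bounded_linear_intro[of _ "cmod c"])
    (simp_all add: scaleC_add_right scaleC_scaleR norm_scaleC_bop mult.commute)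

text \<open>Completeness is inherited from the space of all bounded real-linear operators, as
  complex linearity survives pointwise limits.\<close>

instance bop :: (type) banach
proof
  fix X :: "nat \<Rightarrow> 'a bop"
  assume "Cauchy X"
  then have "Cauchy (\<lambda>n. blinfun_of_bop (X n))"
    unfolding Cauchy_def dist_norm
    by (simp add: norm_bop.rep_eq minus_bop.rep_eq)
  then obtain L where L: "(\<lambda>n. blinfun_of_bop (X n)) \<longlonglongrightarrow> L"
    using Cauchy_convergent convergent_def by blast
  have pt: "(\<lambda>n. X n \<cdot> x) \<longlonglongrightarrow> blinfun_apply L x" for x
    by (intro tendsto_intros L)
  have sc: "bounded_linear (\<lambda>x :: 'a ell2. c *\<^sub>C x)" for c
    by (rule bounded_linear_intro[of _ "cmod c"])
      (simp_all add: scaleC_add_right scaleC_scaleR norm_scaleC_ell2 mult.commute)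
  have "blinfun_apply L (c *\<^sub>C x) = c *\<^sub>C blinfun_apply L x" for c x
  proof (rule LIMSEQ_unique[OF pt])
    show "(\<lambda>n. X n \<cdot> (c *\<^sub>C x)) \<longlonglongrightarrow> c *\<^sub>C blinfun_apply L x"
      unfolding bop_scaleC by (rule bounded_linear.tendsto[OF sc pt])
  qed
  then have T: "blinfun_of_bop (Abs_bop L) = L"
    by (simp add: Abs_bop_inverse)
  have "X \<longlonglongrightarrow> Abs_bop L"
    using L unfolding tendsto_iff dist_norm
    by (simp add: norm_bop.rep_eq minus_bop.rep_eq T)
  then show "convergent X"
    by (rule convergentI)
qed

subsection \<open>The adjoint\<close>

lemma cinner_adj_right: "cinner x (adj T \<cdot> y) = cinner (T \<cdot> x) y"
  by (metis cinner_adj cinner_commute)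

lemma bop_eq_cinnerI:
  assumes "\<And>x y. cinner (S \<cdot> x) y = cinner (T \<cdot> x) y"
  shows "S = T"
  using assms by (rule adj_unique)

lemma adj_adj [simp]: "adj (adj T) = T"
  by (rule bop_eq_cinnerI) (simp add: cinner_adj cinner_adj_right)

lemma adj_mult: "adj (S * T) = adj T * adj S"
  by (rule bop_eq_cinnerI) (simp add: cinner_adj bop_simps)

lemma adj_add: "adj (S + T) = adj S + adj T"
  by (rule bop_eq_cinnerI) (simp add: cinner_adj bop_simps cinner_add_left cinner_add_right)

lemma adj_scaleC: "adj (c *\<^sub>C T) = cnj c *\<^sub>C adj T"
  by (rule bop_eq_cinnerI)
    (simp add: cinner_adj bop_simps cinner_scaleC_left cinner_scaleC_right)

lemma adj_zero [simp]: "adj 0 = 0"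
  by (rule bop_eq_cinnerI) (simp add: cinner_adj bop_simps)

lemma adj_diff: "adj (S - T) = adj S - adj T"
  using adj_add[of "S - T" T] by simp

lemma adj_sum: "adj (\<Sum>i\<in>F. f i) = (\<Sum>i\<in>F. adj (f i))"
  by (induction F rule: infinite_finite_induct) (simp_all add: adj_add)

lemma cinner_eq_0_iff: "cinner x x = 0 \<longleftrightarrow> x = 0"
  by (simp add: cinner_norm)

lemma adj_mult_self_eq_0:
  assumes "adj T * T = 0"
  shows "T = 0"
proof (rule bop_eqI)
  fix x
  have "cinner (T \<cdot> x) (T \<cdot> x) = cinner x ((adj T * T) \<cdot> x)"
    by (simp add: bop_simps cinner_adj_right)
  then show "T \<cdot> x = 0 \<cdot> x"
    by (simp add: assms bop_simps cinner_eq_0_iff)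
qed

lemma norm_adj_le: "norm (adj T) \<le> norm T"
proof (rule norm_bop_leI)
  fix x
  let ?y = "adj T \<cdot> x"
  have "(norm ?y)\<^sup>2 = cmod (cinner x (T \<cdot> ?y))"
    by (metis cinner_adj cinner_norm norm_of_real abs_power2)
  also have "\<dots> \<le> norm x * (norm T * norm ?y)"
    by (rule order_trans[OF cmod_cinner_le]) (intro mult_left_mono norm_bop_apply norm_ge_zero)
  finally show "norm ?y \<le> norm T * norm x"
    by (cases "norm ?y = 0") (simp_all add: power2_eq_square ac_simps)
qed simp

lemma norm_adj [simp]: "norm (adj T) = norm T"
  by (metis norm_adj_le adj_adj antisym)

lemma bounded_linear_adj: "bounded_linear adj"
  by (rule bounded_linear_intro[of _ 1]) (simp_all add: adj_add scaleR_scaleC adj_scaleC)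

subsection \<open>Closed algebras generated by sets\<close>

lemma csubspaceD:
  assumes "csubspace S"
  shows "0 \<in> S" "x \<in> S \<Longrightarrow> y \<in> S \<Longrightarrow> x + y \<in> S" "x \<in> S \<Longrightarrow> c *\<^sub>C x \<in> S"
  using assms unfolding csubspace_def by blast+

lemma csubspace_diff: "csubspace S \<Longrightarrow> x \<in> S \<Longrightarrow> y \<in> S \<Longrightarrow> x - y \<in> S"
  using csubspaceD(2)[of S x "(- 1) *\<^sub>C y"] csubspaceD(3)[of S y "- 1"] by (simp add: scaleC_minus_one)

lemma csubspace_sum: "csubspace S \<Longrightarrow> (\<And>i. i \<in> F \<Longrightarrow> f i \<in> S) \<Longrightarrow> (\<Sum>i\<in>F. f i) \<in> S"
  by (induction F rule: infinite_finite_induct) (auto simp: csubspaceD)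

lemma closed_algebraD:
  assumes "closed_algebra S"
  shows "csubspace S" "x \<in> S \<Longrightarrow> y \<in> S \<Longrightarrow> x * y \<in> S" "closed S"
  using assms unfolding closed_algebra_def by blast+

lemma cstar_algebraD:
  assumes "cstar_algebra S"
  shows "closed_algebra S" "x \<in> S \<Longrightarrow> adj x \<in> S"
  using assms unfolding cstar_algebra_def by blast+

lemma closed_algebra_Inter: "Ball \<T> closed_algebra \<Longrightarrow> closed_algebra (\<Inter>\<T>)"
  unfolding closed_algebra_def csubspace_def by (auto intro!: closed_Inter)

lemma closed_algebra_hull: "closed_algebra (closed_algebra hull S)"
  by (rule hull_in) (rule closed_algebra_Inter)

lemma cstar_algebra_hull: "cstar_algebra (cstar_algebra hull S)"
  by (rule hull_in) (auto simp: cstar_algebra_def intro!: closed_algebra_Inter)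

lemma toeplitz_algebra_plus_subset: "toeplitz_algebra_plus A E \<pi> t \<subseteq> toeplitz_algebra A E \<pi> t"
  unfolding toeplitz_algebra_plus_def toeplitz_algebra_def
  by (rule hull_antimono) (simp add: cstar_algebra_def)

lemma clinear_onD:
  assumes "clinear_on S f"
  shows "x \<in> S \<Longrightarrow> y \<in> S \<Longrightarrow> f (x + y) = f x + f y" "x \<in> S \<Longrightarrow> f (c *\<^sub>C x) = c *\<^sub>C f x"
  using assms unfolding clinear_on_def by blast+

lemma clinear_on_zero: "clinear_on S f \<Longrightarrow> csubspace S \<Longrightarrow> f 0 = 0"
  using clinear_onD(2)[of S f 0 0] csubspaceD(1)[of S]
  by (metis add_cancel_right_left clinear_onD(1) add.right_neutral)

lemma clinear_on_diff:
  "clinear_on S f \<Longrightarrow> csubspace S \<Longrightarrow> x \<in> S \<Longrightarrow> y \<in> S \<Longrightarrow> f (x - y) = f x - f y"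
  using clinear_onD(1)[of S f x "(- 1) *\<^sub>C y"] clinear_onD(2)[of S f y "- 1"] csubspaceD(3)[of S y "- 1"]
  by (simp add: scaleC_minus_one)

lemma clinear_on_sum:
  assumes "clinear_on S f" "csubspace S" "\<And>i. i \<in> F \<Longrightarrow> g i \<in> S"
  shows "f (\<Sum>i\<in>F. g i) = (\<Sum>i\<in>F. f (g i))"
  using assms(3)
  by (induction F rule: infinite_finite_induct)
    (auto simp: clinear_on_zero[OF assms(1,2)] clinear_onD[OF assms(1)] csubspace_sum[OF assms(2)])

lemma alg_hom_onD:
  assumes "alg_hom_on S f"
  shows "clinear_on S f" "x \<in> S \<Longrightarrow> y \<in> S \<Longrightarrow> f (x * y) = f x * f y"
  using assms unfolding alg_hom_on_def mult_on_def by blast+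

lemma star_hom_onD:
  assumes "star_hom_on S f"
  shows "alg_hom_on S f" "x \<in> S \<Longrightarrow> f (adj x) = adj (f x)"
  using assms unfolding star_hom_on_def by blast+

section \<open>Star homomorphisms are contractive\<close>

text \<open>The functional equation says \<open>1 - y = (1 - c)\<^sup>2\<close>: it provides the square root of \<open>1 - y\<close>
  without leaving the possibly non-unital algebra, as the fixed point of \<open>c \<mapsto> (y + c\<^sup>2) / 2\<close>,
  which maps the ball of radius \<open>norm y\<close> to itself and contracts it by that factor.\<close>

lemma quadratic_fixed_point:
  assumes S: "cstar_algebra S" and y: "y \<in> S" "adj y = y" "norm y < 1"
  shows "\<exists>c\<in>S. adj c = c \<and> y = 2 *\<^sub>C c - c * c"
proof -
  define B where "B = {c \<in> S. adj c = c} \<inter> cball 0 (norm y)"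
  define g where "g c = (1/2) *\<^sub>C (y + c * c)" for c :: "'a bop"
  have alg: "closed_algebra S" and sub: "csubspace S"
    using S by (auto dest: cstar_algebraD closed_algebraD)
  have "{c \<in> S. adj c = c} = S \<inter> {c. adj c = c}"
    by auto
  moreover have "closed {c :: 'a bop. adj c = c}"
    by (intro closed_Collect_eq continuous_intros linear_continuous_on bounded_linear_adj)
  ultimately have "closed B"
    unfolding B_def using closed_algebraD(3)[OF alg] by (auto intro!: closed_Int)
  then have complete: "complete B"
    by (simp add: complete_eq_closed)
  have norm_B: "norm c \<le> norm y" if "c \<in> B" for c
    using that by (simp add: B_def)
  have "g ` B \<subseteq> B"
  proof safe
    fix c assume c: "c \<in> B"
    have "norm (y + c * c) \<le> norm y + norm c * norm c"
      using norm_triangle_ineq[of y "c * c"] norm_mult_ineq[of c c] by linarith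
    also have "norm c * norm c \<le> norm y * 1"
      using norm_B[OF c] y(3) by (intro mult_mono) auto
    finally have "norm (g c) \<le> norm y"
      by (simp add: g_def norm_scaleC_bop)
    moreover have "g c \<in> S"
      unfolding g_def using c y(1)
      by (intro csubspaceD[OF sub] closed_algebraD(2)[OF alg]) (auto simp: B_def)
    ultimately show "g c \<in> B"
      using c y(2) by (simp add: B_def g_def adj_scaleC adj_add adj_mult)
  qed
  moreover have "dist (g c) (g d) \<le> norm y * dist c d" if cd: "c \<in> B" "d \<in> B" for c d
  proof -
    have "g c - g d = (1/2) *\<^sub>C (c * (c - d) + (c - d) * d)"
      unfolding g_def by (rule bop_eqI)
        (simp add: bop_simps blinfun.diff_right scaleC_diff_right[symmetric])
    then have "dist (g c) (g d) = norm (c * (c - d) + (c - d) * d) / 2"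
      by (simp add: dist_norm norm_scaleC_bop)
    also have "norm (c * (c - d) + (c - d) * d) \<le> norm y * norm (c - d) + norm (c - d) * norm y"
      using norm_B cd
      by (intro order_trans[OF norm_triangle_ineq] add_mono order_trans[OF norm_mult_ineq]
          mult_mono) auto
    finally show ?thesis
      by (simp add: dist_norm)
  qed
  moreover have "B \<noteq> {}"
    using csubspaceD(1)[OF sub] by (auto simp: B_def intro!: exI[of _ 0])
  ultimately obtain c where c: "c \<in> B" "g c = c"
    using Banach_fix[OF complete, of "norm y" g] y(3) by auto
  have "2 *\<^sub>C c = 2 *\<^sub>C g c"
    by (simp add: c)
  then have "2 *\<^sub>C c = y + c * c"
    by (simp add: g_def scaleC_scaleC scaleC_one)
  then show ?thesis
    using c(1) by (intro bexI[of _ c]) (auto simp: B_def)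
qed

text \<open>If \<open>norm a < 1\<close> then \<open>1 - a\<^sup>*a = (1 - c)\<^sup>2\<close> with \<open>c\<close> self-adjoint in the algebra. A star
  homomorphism preserves this identity, so \<open>1 - \<rho>(a)\<^sup>*\<rho>(a)\<close> is again the square of a
  self-adjoint operator and hence positive.\<close>

lemma star_hom_contractive:
  assumes S: "cstar_algebra S" and \<rho>: "star_hom_on S \<rho>" and a: "a \<in> S"
  shows "norm (\<rho> a) \<le> norm a"
proof -
  have alg: "closed_algebra S" and sub: "csubspace S" and \<rho>lin: "clinear_on S \<rho>"
    using S \<rho> by (auto dest: cstar_algebraD closed_algebraD star_hom_onD alg_hom_onD)
  note \<rho>mult = alg_hom_onD(2)[OF star_hom_onD(1)[OF \<rho>]]
  have unit: "norm (\<rho> b) \<le> 1" if b: "b \<in> S" "norm b < 1" for b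
  proof -
    have "norm (adj b * b) \<le> norm b * norm b"
      using norm_mult_ineq[of "adj b" b] by simp
    also have "\<dots> < 1"
      using b(2) mult_strict_mono[of "norm b" 1 "norm b" 1] by simp
    finally obtain c where c: "c \<in> S" "adj c = c" "adj b * b = 2 *\<^sub>C c - c * c"
      using quadratic_fixed_point[OF S, of "adj b * b"] b(1)
      by (auto simp: adj_mult closed_algebraD(2)[OF alg] cstar_algebraD(2)[OF S])
    have "\<rho> (adj b * b) = \<rho> (2 *\<^sub>C c - c * c)"
      by (simp add: c(3))
    then have eq: "adj (\<rho> b) * \<rho> b = 2 *\<^sub>C \<rho> c - \<rho> c * \<rho> c"
      using b(1) c(1)
      by (simp add: \<rho>mult star_hom_onD(2)[OF \<rho>] cstar_algebraD(2)[OF S]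
          clinear_on_diff[OF \<rho>lin sub] clinear_onD(2)[OF \<rho>lin] csubspaceD[OF sub]
          closed_algebraD(2)[OF alg])
    have sa: "adj (\<rho> c) = \<rho> c"
      using star_hom_onD(2)[OF \<rho> c(1)] c(2) by simp
    have "norm (\<rho> b \<cdot> x) \<le> 1 * norm x" for x
    proof -
      let ?z = "x - \<rho> c \<cdot> x"
      have "cinner (\<rho> b \<cdot> x) (\<rho> b \<cdot> x) = cinner x ((adj (\<rho> b) * \<rho> b) \<cdot> x)"
        by (simp add: bop_simps cinner_adj_right)
      also have "\<dots> = cinner x (\<rho> c \<cdot> x + \<rho> c \<cdot> x - \<rho> c \<cdot> \<rho> c \<cdot> x)"
        using scaleC_add_left[of 1 1 "\<rho> c \<cdot> x"] by (simp add: eq bop_simps scaleC_one)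
      also have "Re \<dots> = inner x x - inner ?z ?z"
      proof -
        have "cinner x (\<rho> c \<cdot> \<rho> c \<cdot> x) = cinner (\<rho> c \<cdot> x) (\<rho> c \<cdot> x)"
          by (metis sa cinner_adj)
        then have "inner x (\<rho> c \<cdot> \<rho> c \<cdot> x) = inner (\<rho> c \<cdot> x) (\<rho> c \<cdot> x)"
          by (simp add: inner_ell2_def)
        then show ?thesis
          unfolding inner_ell2_def[symmetric]
          by (simp add: inner_diff_left inner_diff_right inner_add_right inner_commute)
      qed
      finally have "(norm (\<rho> b \<cdot> x))\<^sup>2 \<le> (norm x)\<^sup>2"
        by (simp add: power2_norm_eq_inner flip: inner_ell2_def)
      then show ?thesis
        using power2_le_imp_le by fastforce
    qed
    then show ?thesis
      by (intro norm_bop_leI) auto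
  qed
  show ?thesis
  proof (rule field_le_epsilon)
    fix e :: real assume e: "0 < e"
    define s where "s = norm a + e"
    have s: "s > 0" "norm a < s"
      using e by (auto simp: s_def add_nonneg_pos)
    have "norm (\<rho> (complex_of_real (1 / s) *\<^sub>C a)) \<le> 1"
      using s a by (intro unit csubspaceD(3)[OF sub]) (auto simp: norm_scaleC_bop norm_divide)
    then show "norm (\<rho> a) \<le> norm a + e"
      using s by (simp add: clinear_onD(2)[OF \<rho>lin a] norm_scaleC_bop norm_divide
          flip: s_def)
  qed
qed

section \<open>Changing the index set\<close>

text \<open>An injection of index sets induces an isometry \<open>push\<close> between the Hilbert spaces, with
  adjoint \<open>pull\<close>.\<close>

definition pull :: "('i \<Rightarrow> 'j) \<Rightarrow> 'j ell2 \<Rightarrow> 'i ell2" where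
  "pull h f = Abs_ell2 (\<lambda>i. ell2_apply f (h i))"

definition push :: "('i \<Rightarrow> 'j) \<Rightarrow> 'i ell2 \<Rightarrow> 'j ell2" where
  "push h f = Abs_ell2 (\<lambda>j. if j \<in> range h then ell2_apply f (inv h j) else 0)"

lemma has_sum_norm_ell2: "((\<lambda>i. (cmod (ell2_apply x i))\<^sup>2) has_sum (norm x)\<^sup>2) UNIV"
  using has_sum_infsum[of "\<lambda>i. (cmod (ell2_apply x i))\<^sup>2" UNIV] ell2_apply_square_summable[of x]
  by (simp add: norm_ell2_def infsum_nonneg square_summable_def)

context
  fixes h :: "'i \<Rightarrow> 'j"
  assumes h: "inj h"
begin

lemma L2_set_pull: "finite F \<Longrightarrow> L2_set (\<lambda>i. cmod (ell2_apply f (h i))) F \<le> norm f"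
  using L2_set_le_norm[of "h ` F" f] inj_on_subset[OF h, of F]
  by (simp add: L2_set_def sum.reindex)

lemma ell2_apply_pull: "ell2_apply (pull h f) i = ell2_apply f (h i)"
  using square_summableI[OF L2_set_pull] by (simp add: pull_def Abs_ell2_inverse)

lemma pull_add: "pull h (f + g) = pull h f + pull h g"
  by (rule ell2_eqI) (simp add: ell2_apply_pull plus_ell2.rep_eq)

lemma pull_scaleC: "pull h (c *\<^sub>C f) = c *\<^sub>C pull h f"
  by (rule ell2_eqI) (simp add: ell2_apply_pull scaleC_ell2.rep_eq)

lemma norm_pull_le: "norm (pull h f) \<le> norm f"
  by (rule norm_ell2_leI) (simp add: ell2_apply_pull L2_set_pull)

lemma L2_set_push:
  assumes F: "finite F"
  shows "L2_set (\<lambda>j. cmod (if j \<in> range h then ell2_apply f (inv h j) else 0)) F \<le> norm f"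
proof -
  have "(\<Sum>j\<in>F. (cmod (if j \<in> range h then ell2_apply f (inv h j) else 0))\<^sup>2)
      = (\<Sum>j\<in>F \<inter> range h. (cmod (ell2_apply f (inv h j)))\<^sup>2)"
    using F by (intro sum.mono_neutral_cong_right) auto
  also have "\<dots> = (\<Sum>i\<in>inv h ` (F \<inter> range h). (cmod (ell2_apply f i))\<^sup>2)"
    by (subst sum.reindex) (auto intro: inj_on_subset[OF inj_on_inv_into])
  finally show ?thesis
    using L2_set_le_norm[of "inv h ` (F \<inter> range h)" f] F by (simp add: L2_set_def)
qed

lemma ell2_apply_push:
  "ell2_apply (push h f) j = (if j \<in> range h then ell2_apply f (inv h j) else 0)"
  using square_summableI[OF L2_set_push, of f] by (simp add: push_def Abs_ell2_inverse)

lemma ell2_apply_push_image: "ell2_apply (push h f) (h i) = ell2_apply f i"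
  using h by (simp add: ell2_apply_push)

lemma push_add: "push h (f + g) = push h f + push h g"
  by (rule ell2_eqI) (simp add: ell2_apply_push plus_ell2.rep_eq)

lemma push_scaleC: "push h (c *\<^sub>C f) = c *\<^sub>C push h f"
  by (rule ell2_eqI) (simp add: ell2_apply_push scaleC_ell2.rep_eq)

lemma pull_push [simp]: "pull h (push h f) = f"
  by (rule ell2_eqI) (simp add: ell2_apply_pull ell2_apply_push_image)

lemma cinner_push_left: "cinner (push h f) g = cinner f (pull h g)"
proof -
  have "cinner (push h f) g = (\<Sum>\<^sub>\<infinity>j\<in>range h. cnj (ell2_apply (push h f) j) * ell2_apply g j)"
    unfolding cinner.rep_eq by (rule infsum_cong_neutral) (auto simp: ell2_apply_push)
  also have "\<dots> = (\<Sum>\<^sub>\<infinity>i. cnj (ell2_apply (push h f) (h i)) * ell2_apply g (h i))"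
    by (subst infsum_reindex[OF h]) (simp add: comp_def)
  finally show ?thesis
    by (simp add: cinner.rep_eq ell2_apply_pull ell2_apply_push_image)
qed

lemma cinner_push_right: "cinner g (push h f) = cinner (pull h g) f"
  by (metis cinner_push_left cinner_commute)

lemma norm_push [simp]: "norm (push h f) = norm f"
proof -
  have "cinner (push h f) (push h f) = cinner f f"
    by (simp add: cinner_push_left)
  then have "(norm (push h f))\<^sup>2 = (norm f)\<^sup>2"
    unfolding cinner_norm by (simp only: of_real_eq_iff)
  then show ?thesis
    by (simp only: power2_eq_iff_nonneg norm_ge_zero)
qed

lemma push_ket: "push h (ket i) = ket (h i)"
  by (rule ell2_eqI) (use h in \<open>auto simp: ell2_apply_push ket.rep_eq inj_eq\<close>)

end

text \<open>The Hilbert space adjoint for two different index sets, obtained from the endomorphism case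
  by placing the operator in a corner of the operators over the disjoint union.\<close>

lemma adjoint_exists:
  fixes W :: "'i ell2 \<Rightarrow> 'j ell2"
  assumes add: "\<And>x y. W (x + y) = W x + W y" and scale: "\<And>c x. W (c *\<^sub>C x) = c *\<^sub>C W x"
    and bound: "\<And>x. norm (W x) \<le> norm x"
  obtains W' where "\<And>x y. cinner (W' y) x = cinner y (W x)"
    "\<And>x y. W' (x + y) = W' x + W' y" "\<And>c x. W' (c *\<^sub>C x) = c *\<^sub>C W' x"
    "\<And>x. norm (W' x) \<le> norm x"
proof -
  have Inl: "inj (Inl :: 'i \<Rightarrow> 'i + 'j)" and Inr: "inj (Inr :: 'j \<Rightarrow> 'i + 'j)"
    by auto
  have "\<exists>T. \<forall>x :: ('i + 'j) ell2. T \<cdot> x = push Inr (W (pull Inl x))"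
  proof (rule bop_construct)
    show "norm (push Inr (W (pull Inl x))) \<le> norm x * 1" for x :: "('i + 'j) ell2"
      using order_trans[OF bound norm_pull_le[OF Inl]] by (simp add: norm_push[OF Inr])
  qed (simp_all add: pull_add[OF Inl] push_add[OF Inr] pull_scaleC[OF Inl] push_scaleC[OF Inr]
      add scale)
  then obtain T where T: "\<And>x :: ('i + 'j) ell2. T \<cdot> x = push Inr (W (pull Inl x))"
    by blast
  define W' where "W' y = pull Inl (adj T \<cdot> push Inr y)" for y
  have adjoint: "cinner (W' y) x = cinner y (W x)" for x y
    by (simp add: W'_def cinner_push_right[OF Inl, symmetric] cinner_adj T
        cinner_push_left[OF Inr] pull_push[OF Inr] pull_push[OF Inl])
  have "norm (W' y) \<le> norm y" for y
  proof -
    have "(norm (W' y))\<^sup>2 = cmod (cinner y (W (W' y)))"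
      using adjoint[of y "W' y"] by (metis cinner_norm norm_of_real abs_power2)
    also have "\<dots> \<le> norm y * norm (W' y)"
      by (rule order_trans[OF cmod_cinner_le]) (intro mult_left_mono bound norm_ge_zero)
    finally show ?thesis
      by (cases "norm (W' y) = 0") (simp_all add: power2_eq_square)
  qed
  with adjoint show ?thesis
    by (intro that[of W'])
      (simp_all add: W'_def push_add[OF Inr] push_scaleC[OF Inr] pull_add[OF Inl]
        pull_scaleC[OF Inl] blinfun.add_right bop_scaleC)
qed

text \<open>The operator \<open>push h \<circ> x \<circ> pull g\<close>. For \<open>h = g\<close> it is the copy of \<open>x\<close> on the range of
  \<open>push h\<close>, extended by zero; for two legs \<open>h\<close>, \<open>g\<close> it is a matrix with a single entry.\<close>

definition corner :: "('i \<Rightarrow> 'j) \<Rightarrow> ('i \<Rightarrow> 'j) \<Rightarrow> 'i bop \<Rightarrow> 'j bop" where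
  "corner h g x = (SOME T. \<forall>f. T \<cdot> f = push h (x \<cdot> pull g f))"

lemma corner_apply:
  assumes h: "inj h" and g: "inj g"
  shows "corner h g x \<cdot> f = push h (x \<cdot> pull g f)"
proof -
  have "\<exists>T. \<forall>f. T \<cdot> f = push h (x \<cdot> pull g f)"
  proof (rule bop_construct)
    show "norm (push h (x \<cdot> pull g f)) \<le> norm f * norm x" for f
      using order_trans[OF norm_bop_apply[of x "pull g f"]
          mult_left_mono[OF norm_pull_le[OF g, of f] norm_ge_zero[of x]]]
      by (simp add: norm_push[OF h] mult.commute)
  qed (simp_all add: pull_add[OF g] push_add[OF h] pull_scaleC[OF g] push_scaleC[OF h]
      blinfun.add_right bop_scaleC)
  from someI_ex[OF this] show ?thesis
    unfolding corner_def by blast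
qed

lemma
  assumes h: "inj h" and g: "inj g"
  shows corner_add: "corner h g (x + y) = corner h g x + corner h g y"
    and corner_scaleC: "corner h g (c *\<^sub>C x) = c *\<^sub>C corner h g x"
    and bounded_linear_corner: "bounded_linear (corner h g)"
    and adj_corner: "adj (corner h g x) = corner g h (adj x)"
proof -
  show add: "corner h g (x + y) = corner h g x + corner h g y" for x y
    by (rule bop_eqI) (simp add: corner_apply[OF h g] bop_simps push_add[OF h])
  show scale: "corner h g (c *\<^sub>C x) = c *\<^sub>C corner h g x" for c x
    by (rule bop_eqI) (simp add: corner_apply[OF h g] bop_simps push_scaleC[OF h])
  have bound: "norm (corner h g x) \<le> norm x" for x
  proof (rule norm_bop_leI)
    show "norm (corner h g x \<cdot> f) \<le> norm x * norm f" for f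
      using order_trans[OF norm_bop_apply[of x "pull g f"]
          mult_left_mono[OF norm_pull_le[OF g, of f] norm_ge_zero[of x]]]
      by (simp add: corner_apply[OF h g] norm_push[OF h])
  qed simp
  show "bounded_linear (corner h g)"
    by (rule bounded_linear_intro[of _ 1]) (simp_all add: add scale scaleR_scaleC bound)
  show "adj (corner h g x) = corner g h (adj x)"
    by (rule bop_eq_cinnerI)
      (simp add: cinner_adj corner_apply[OF h g] corner_apply[OF g h] cinner_push_left[OF g]
        cinner_push_right[OF h])
qed

lemma corner_mult:
  assumes h: "inj h" and g: "inj g" and k: "inj k"
  shows "corner h g x * corner g k y = corner h k (x * y)"
  by (rule bop_eqI)
    (simp add: bop_simps corner_apply[OF h g] corner_apply[OF g k] corner_apply[OF h k]
      pull_push[OF g])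

section \<open>Ampliations and matrices of operators\<close>

text \<open>\<open>push (leg k)\<close> is the embedding \<open>f \<mapsto> f \<otimes> ket k\<close> into the tensor product, and \<open>slice k\<close> is
  its adjoint.\<close>

abbreviation leg :: "'k \<Rightarrow> 'i \<Rightarrow> 'i \<times> 'k" where
  "leg k \<equiv> \<lambda>i. (i, k)"

abbreviation slice :: "'k \<Rightarrow> ('i \<times> 'k) ell2 \<Rightarrow> 'i ell2" where
  "slice k \<equiv> pull (leg k)"

lemma inj_leg: "inj (leg k)"
  by (simp add: inj_on_def)

lemmas ell2_apply_slice = ell2_apply_pull[OF inj_leg]

lemmas slice_simps = pull_add[OF inj_leg] pull_scaleC[OF inj_leg]

lemma slice_push_leg: "slice k (push (leg l) f) = (if k = l then f else 0)"
  by (rule ell2_eqI)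
    (auto simp: ell2_apply_slice ell2_apply_push[OF inj_leg] inv_f_f[OF inj_leg]
      zero_ell2.rep_eq)

lemma slice_zero: "slice k 0 = 0"
  by (rule ell2_eqI) (simp add: ell2_apply_slice zero_ell2.rep_eq)

lemma slice_sum: "slice k (\<Sum>i\<in>F. f i) = (\<Sum>i\<in>F. slice k (f i))"
  by (induction F rule: infinite_finite_induct) (simp_all add: slice_simps slice_zero)

lemma ell2_eq_sliceI: "f = g" if "\<And>k. slice k f = slice k g"
proof (rule ell2_eqI)
  fix p
  show "ell2_apply f p = ell2_apply g p"
    using that[of "snd p"] ell2_apply_slice[of "snd p" f "fst p"]
      ell2_apply_slice[of "snd p" g "fst p"] by simp
qed

lemma has_sum_norm_slice:
  fixes f :: "('i \<times> 'k) ell2"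
  shows "((\<lambda>k. (norm (slice k f))\<^sup>2) has_sum (norm f)\<^sup>2) UNIV"
proof -
  have "bij_betw prod.swap (UNIV :: ('k \<times> 'i) set) UNIV"
    by (simp add: bij_swap)
  from has_sum_reindex_bij_betw[OF this, of "\<lambda>p. (cmod (ell2_apply f p))\<^sup>2"] has_sum_norm_ell2[of f]
  have "((\<lambda>p. (cmod (ell2_apply f (prod.swap p)))\<^sup>2) has_sum (norm f)\<^sup>2) (Sigma UNIV (\<lambda>_. UNIV))"
    by simp
  then show ?thesis
    by (rule has_sum_Sigma') (use has_sum_norm_ell2[of "slice _ f"] in \<open>simp add: ell2_apply_slice\<close>)
qed

lemma sum_norm_slice_le: "finite F \<Longrightarrow> (\<Sum>k\<in>F. (norm (slice k f))\<^sup>2) \<le> (norm f)\<^sup>2"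
  by (rule finite_sum_le_has_sum[OF has_sum_norm_slice]) auto

lemma norm_ell2_le_slices:
  assumes "0 \<le> B" "\<And>F. finite F \<Longrightarrow> (\<Sum>k\<in>F. (norm (slice k f))\<^sup>2) \<le> B\<^sup>2"
  shows "norm f \<le> B"
proof -
  have "(norm f)\<^sup>2 \<le> B\<^sup>2"
    by (rule has_sum_le_finite_sums[OF has_sum_norm_slice]) (rule assms(2))
  then show ?thesis
    using assms(1) by (rule power2_le_imp_le)
qed

subsection \<open>Ampliation of a single operator\<close>

text \<open>\<open>ampl x\<close> is the operator \<open>x \<otimes> 1\<close> on the tensor product of two Hilbert spaces.\<close>

definition ampl :: "'i bop \<Rightarrow> ('i \<times> 'k) bop" where
  "ampl x = (SOME T. \<forall>f k. slice k (T \<cdot> f) = x \<cdot> slice k f)"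

lemma slice_ampl:
  fixes f :: "('i \<times> 'k) ell2"
  shows "slice k (ampl x \<cdot> f) = x \<cdot> slice k f"
proof -
  let ?g = "\<lambda>(f :: ('i \<times> 'k) ell2) p. ell2_apply (x \<cdot> slice (snd p) f) (fst p)"
  have bound: "L2_set (\<lambda>p. cmod (?g f p)) F \<le> norm f * norm x" if F: "finite F" for f F
  proof -
    have "(\<Sum>p\<in>F. (cmod (?g f p))\<^sup>2) \<le> (\<Sum>p\<in>fst ` F \<times> snd ` F. (cmod (?g f p))\<^sup>2)"
      using F by (intro sum_mono2) (auto simp: rev_image_eqI)
    also have "\<dots> = (\<Sum>k\<in>snd ` F. \<Sum>i\<in>fst ` F. (cmod (ell2_apply (x \<cdot> slice k f) i))\<^sup>2)"
      by (subst sum.swap) (simp add: sum.cartesian_product case_prod_unfold)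
    also have "\<dots> \<le> (\<Sum>k\<in>snd ` F. (norm x)\<^sup>2 * (norm (slice k f))\<^sup>2)"
    proof (rule sum_mono)
      fix k
      have "(\<Sum>i\<in>fst ` F. (cmod (ell2_apply (x \<cdot> slice k f) i))\<^sup>2) \<le> (norm (x \<cdot> slice k f))\<^sup>2"
        using has_sum_norm_ell2[of "x \<cdot> slice k f"] F
        by (intro finite_sum_le_has_sum[where B = "fst ` F"]) auto
      also have "\<dots> \<le> (norm x)\<^sup>2 * (norm (slice k f))\<^sup>2"
        using power_mono[OF norm_bop_apply[of x "slice k f"] norm_ge_zero, of 2]
        by (simp add: power_mult_distrib)
      finally show "(\<Sum>i\<in>fst ` F. (cmod (ell2_apply (x \<cdot> slice k f) i))\<^sup>2)
          \<le> (norm x)\<^sup>2 * (norm (slice k f))\<^sup>2" .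
    qed
    also have "\<dots> \<le> (norm x)\<^sup>2 * (norm f)\<^sup>2"
      unfolding sum_distrib_left[symmetric] using F
      by (intro mult_left_mono sum_norm_slice_le) auto
    finally show ?thesis
      unfolding L2_set_def
      by (intro real_le_lsqrt) (auto simp: power_mult_distrib mult.commute sum_nonneg)
  qed
  define g where "g f = Abs_ell2 (?g f)" for f
  have g: "ell2_apply (g f) p = ?g f p" for f p
    unfolding g_def using square_summableI[of "?g f", OF bound] by (simp add: Abs_ell2_inverse)
  have "\<exists>T. \<forall>f. T \<cdot> f = g f"
  proof (rule bop_construct)
    show "norm (g f) \<le> norm f * norm x" for f
      by (rule norm_ell2_leI) (simp only: g bound)
  qed (rule ell2_eqI; simp add: g plus_ell2.rep_eq scaleC_ell2.rep_eq slice_simps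
      blinfun.add_right bop_scaleC)+
  then obtain T where T: "\<And>f. T \<cdot> f = g f"
    by blast
  have "slice k (T \<cdot> f) = x \<cdot> slice k f" for f k
    by (rule ell2_eqI) (simp add: ell2_apply_slice T g)
  then have "\<exists>T. \<forall>(f :: ('i \<times> 'k) ell2) k. slice k (T \<cdot> f) = x \<cdot> slice k f"
    by blast
  from someI_ex[OF this] show ?thesis
    unfolding ampl_def by blast
qed

lemma ampl_add: "ampl (x + y) = ampl x + ampl y"
  by (rule bop_eqI, rule ell2_eq_sliceI) (simp add: slice_ampl bop_simps slice_simps)

lemma ampl_scaleC: "ampl (c *\<^sub>C x) = c *\<^sub>C ampl x"
  by (rule bop_eqI, rule ell2_eq_sliceI) (simp add: slice_ampl bop_simps slice_simps)

lemma ampl_mult: "ampl (x * y) = ampl x * ampl y"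
  by (rule bop_eqI, rule ell2_eq_sliceI) (simp add: slice_ampl bop_simps)

lemma ampl_ket: "ampl x \<cdot> ket (i, k) = push (leg k) (x \<cdot> ket i)"
  by (rule ell2_eq_sliceI)
    (simp add: slice_ampl slice_push_leg bop_simps flip: push_ket[OF inj_leg])

lemma adj_ampl: "adj (ampl x) = ampl (adj x)"
proof (rule bop_eqI, rule ell2_eqI)
  fix f and p :: "'a \<times> 'b"
  obtain i k where p: "p = (i, k)"
    by (cases p)
  have "ell2_apply (adj (ampl x) \<cdot> f) p = cinner (push (leg k) (x \<cdot> ket i)) f"
    unfolding p by (simp add: cinner_adj_right ampl_ket flip: cinner_ket)
  also have "\<dots> = cinner (ket i) (adj x \<cdot> slice k f)"
    by (simp add: cinner_push_left[OF inj_leg] cinner_adj_right)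
  also have "\<dots> = ell2_apply (ampl (adj x) \<cdot> f) p"
    unfolding p by (simp add: cinner_ket ell2_apply_slice[symmetric] slice_ampl)
  finally show "ell2_apply (adj (ampl x) \<cdot> f) p = ell2_apply (ampl (adj x) \<cdot> f) p" .
qed

lemma ell2_apply_ampl_adj:
  "ell2_apply (ampl (adj x) \<cdot> f) (\<mu>, k) = cinner (x \<cdot> ket \<mu>) (slice k f)"
proof -
  have "ell2_apply (ampl (adj x) \<cdot> f) (\<mu>, k) = ell2_apply (adj x \<cdot> slice k f) \<mu>"
    by (simp add: slice_ampl flip: ell2_apply_slice)
  then show ?thesis
    by (simp add: cinner_adj_right flip: cinner_ket)
qed

subsection \<open>Matrices as operators\<close>

definition block :: "nat \<Rightarrow> (nat \<Rightarrow> nat \<Rightarrow> 'i bop) \<Rightarrow> ('i \<times> nat) bop" where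
  "block n x = (\<Sum>i<n. \<Sum>j<n. corner (leg i) (leg j) (x i j))"

definition entry :: "nat \<Rightarrow> nat \<Rightarrow> ('i \<times> nat) bop \<Rightarrow> 'i bop" where
  "entry i j Y = (SOME T. \<forall>f. T \<cdot> f = slice i (Y \<cdot> push (leg j) f))"

lemma slice_block: "slice i (block n x \<cdot> f) = (if i < n then \<Sum>j<n. x i j \<cdot> slice j f else 0)"
proof -
  have "slice i (block n x \<cdot> f) = (\<Sum>i'<n. \<Sum>j<n. if i = i' then x i' j \<cdot> slice j f else 0)"
    by (simp add: block_def bop_sum_apply slice_sum corner_apply[OF inj_leg inj_leg]
        slice_push_leg)
  also have "\<dots> = (\<Sum>i'<n. if i = i' then \<Sum>j<n. x i' j \<cdot> slice j f else 0)"
    by (intro sum.cong) auto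
  finally show ?thesis
    by simp
qed

lemma entry_apply: "entry i j Y \<cdot> f = slice i (Y \<cdot> push (leg j) f)"
proof -
  have "\<exists>T. \<forall>f. T \<cdot> f = slice i (Y \<cdot> push (leg j) f)"
  proof (rule bop_construct)
    show "norm (slice i (Y \<cdot> push (leg j) f)) \<le> norm f * norm Y" for f
      using order_trans[OF norm_pull_le[OF inj_leg] norm_bop_apply[of Y "push (leg j) f"]]
      by (simp add: norm_push[OF inj_leg] mult.commute)
  qed (simp_all add: push_add[OF inj_leg] push_scaleC[OF inj_leg] slice_simps
      blinfun.add_right bop_scaleC)
  from someI_ex[OF this] show ?thesis
    unfolding entry_def by blast
qed

lemma bounded_linear_entry: "bounded_linear (entry i j)"
proof (rule bounded_linear_intro[of _ 1])
  show "entry i j (X + Y) = entry i j X + entry i j Y" for X Y :: "('a \<times> nat) bop"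
    by (rule bop_eqI) (simp add: entry_apply bop_simps slice_simps)
  show "entry i j (r *\<^sub>R X) = r *\<^sub>R entry i j X" for r and X :: "('a \<times> nat) bop"
    by (rule bop_eqI) (simp add: entry_apply scaleR_scaleC bop_simps slice_simps)
  show "norm (entry i j X) \<le> norm X * 1" for X :: "('a \<times> nat) bop"
  proof (rule norm_bop_leI)
    show "norm (entry i j X \<cdot> f) \<le> norm X * 1 * norm f" for f
      using order_trans[OF norm_pull_le[OF inj_leg] norm_bop_apply[of X "push (leg j) f"]]
      by (simp add: entry_apply norm_push[OF inj_leg])
  qed simp
qed

lemma entry_block: "i < n \<Longrightarrow> j < n \<Longrightarrow> entry i j (block n x) = x i j"
proof (rule bop_eqI)
  fix f
  assume ij: "i < n" "j < n"
  then have "entry i j (block n x) \<cdot> f = (\<Sum>j'<n. x i j' \<cdot> (if j' = j then f else 0))"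
    by (simp add: entry_apply slice_block slice_push_leg)
  also have "\<dots> = (\<Sum>j'<n. if j' = j then x i j \<cdot> f else 0)"
    by (intro sum.cong) auto
  finally show "entry i j (block n x) \<cdot> f = x i j \<cdot> f"
    using ij by simp
qed

lemma block_cong: "(\<And>i j. i < n \<Longrightarrow> j < n \<Longrightarrow> x i j = y i j) \<Longrightarrow> block n x = block n y"
  by (simp add: block_def)

lemma block_add: "block n x + block n y = block n (\<lambda>i j. x i j + y i j)"
  by (simp add: block_def corner_add[OF inj_leg inj_leg] sum.distrib)

lemma block_scaleC: "c *\<^sub>C block n x = block n (\<lambda>i j. c *\<^sub>C x i j)"
proof (rule bop_eqI, rule ell2_eq_sliceI)
  fix f i
  have "c *\<^sub>C (\<Sum>j<n. x i j \<cdot> slice j f) = (\<Sum>j<n. c *\<^sub>C (x i j \<cdot> slice j f))"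
    by (induction n) (simp_all add: scaleC_add_right)
  then show "slice i ((c *\<^sub>C block n x) \<cdot> f) = slice i (block n (\<lambda>i j. c *\<^sub>C x i j) \<cdot> f)"
    by (simp add: bop_simps slice_simps slice_block)
qed

lemma block_mult: "block n x * block n y = block n (\<lambda>i j. \<Sum>k<n. x i k * y k j)"
proof (rule bop_eqI, rule ell2_eq_sliceI)
  fix f i
  have "(\<Sum>k<n. x i k \<cdot> (\<Sum>j<n. y k j \<cdot> slice j f)) = (\<Sum>j<n. \<Sum>k<n. x i k \<cdot> y k j \<cdot> slice j f)"
    unfolding blinfun.sum_right by (rule sum.swap)
  then show "slice i ((block n x * block n y) \<cdot> f)
      = slice i (block n (\<lambda>i j. \<Sum>k<n. x i k * y k j) \<cdot> f)"
    by (simp add: bop_simps slice_block bop_sum_apply)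
qed

lemma adj_block: "adj (block n x) = block n (\<lambda>i j. adj (x j i))"
  unfolding block_def adj_sum adj_corner[OF inj_leg inj_leg] by (rule sum.swap)

lemma norm_block_apply: "norm (block n x \<cdot> f) = L2_set (\<lambda>i. norm (\<Sum>j<n. x i j \<cdot> slice j f)) {..<n}"
proof -
  have "((\<lambda>i. (norm (slice i (block n x \<cdot> f)))\<^sup>2) has_sum
      (\<Sum>i<n. (norm (slice i (block n x \<cdot> f)))\<^sup>2)) {..<n}"
    by (rule has_sum_finite) simp
  then have "((\<lambda>i. (norm (slice i (block n x \<cdot> f)))\<^sup>2) has_sum
      (\<Sum>i<n. (norm (slice i (block n x \<cdot> f)))\<^sup>2)) UNIV"
    by (rule has_sum_cong_neutral[THEN iffD1, rotated -1]) (auto simp: slice_block)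
  then have "(norm (block n x \<cdot> f))\<^sup>2 = (\<Sum>i<n. (norm (slice i (block n x \<cdot> f)))\<^sup>2)"
    using has_sum_norm_slice has_sum_unique by blast
  then have "norm (block n x \<cdot> f) = L2_set (\<lambda>i. norm (slice i (block n x \<cdot> f))) {..<n}"
    by (metis L2_set_def norm_ge_zero real_sqrt_unique)
  then show ?thesis
    by (simp add: slice_block L2_set_def)
qed

lemma L2_set_block:
  "L2_set (\<lambda>i. norm (\<Sum>j<n. x i j \<cdot> h j)) {..<n}
    \<le> norm (block n x) * L2_set (\<lambda>j. norm (h j)) {..<n}"
proof -
  define f where "f = (\<Sum>j<n. push (leg j) (h j))"
  have slice_f: "slice j f = (if j < n then h j else 0)" for j
    by (simp add: f_def slice_sum slice_push_leg)
  have norm_f: "norm f \<le> L2_set (\<lambda>j. norm (h j)) {..<n}"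
  proof (rule norm_ell2_le_slices)
    fix F :: "nat set" assume F: "finite F"
    have "(\<Sum>k\<in>F. (norm (slice k f))\<^sup>2) = (\<Sum>k\<in>F \<inter> {..<n}. (norm (h k))\<^sup>2)"
      using F by (intro sum.mono_neutral_cong_right) (auto simp: slice_f)
    also have "\<dots> \<le> (\<Sum>k<n. (norm (h k))\<^sup>2)"
      by (rule sum_mono2) auto
    finally show "(\<Sum>k\<in>F. (norm (slice k f))\<^sup>2) \<le> (L2_set (\<lambda>j. norm (h j)) {..<n})\<^sup>2"
      by (simp add: L2_set_def sum_nonneg)
  qed simp
  have "L2_set (\<lambda>i. norm (\<Sum>j<n. x i j \<cdot> h j)) {..<n} = norm (block n x \<cdot> f)"
    by (simp add: norm_block_apply slice_f)
  also have "\<dots> \<le> norm (block n x) * norm f"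
    by (rule norm_bop_apply)
  also have "\<dots> \<le> norm (block n x) * L2_set (\<lambda>j. norm (h j)) {..<n}"
    by (rule mult_left_mono[OF norm_f norm_ge_zero])
  finally show ?thesis .
qed

lemma L2_set_scale: "0 \<le> s \<Longrightarrow> L2_set (\<lambda>i. s * f i) F = s * L2_set f F"
  by (simp add: L2_set_right_distrib)

text \<open>A tuple of vectors is the same as a vector on the tensor product, namely the one with these
  slices; scaling reduces the operator norm to the unit ball in the definition of \<open>matrix_norm\<close>.\<close>

theorem matrix_norm_eq_norm_block: "matrix_norm n x = norm (block n x)"
proof (rule antisym)
  let ?L = "\<lambda>h. L2_set (\<lambda>i. norm (\<Sum>j<n. x i j \<cdot> h j)) {..<n}"
  let ?N = "\<lambda>h :: nat \<Rightarrow> 'a ell2. L2_set (\<lambda>j. norm (h j)) {..<n}"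
  have le: "?L h \<le> norm (block n x)" if "?N h \<le> 1" for h
    using L2_set_block[where x = x and h = h and n = n] mult_left_mono[OF that norm_ge_zero[of "block n x"]]
    by simp
  have ne: "{h :: nat \<Rightarrow> 'a ell2. ?N h \<le> 1} \<noteq> {}"
    by (auto intro!: exI[of _ "\<lambda>_. 0"] simp: L2_set_def)
  show "matrix_norm n x \<le> norm (block n x)"
    unfolding matrix_norm_def using ne le by (intro cSUP_least) auto
  have bdd: "bdd_above (?L ` {h. ?N h \<le> 1})"
    using le by (auto intro!: bdd_aboveI)
  have sup: "?L h \<le> matrix_norm n x" if "?N h \<le> 1" for h
    unfolding matrix_norm_def using bdd that by (intro cSUP_upper) auto
  show "norm (block n x) \<le> matrix_norm n x"
  proof (rule norm_bop_leI)
    show "0 \<le> matrix_norm n x"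
      using sup[of "\<lambda>_. 0"] by (simp add: L2_set_def)
    fix f
    show "norm (block n x \<cdot> f) \<le> matrix_norm n x * norm f"
    proof (cases "f = 0")
      case False
      define c where "c = complex_of_real (1 / norm f)"
      have "norm (slice j (c *\<^sub>C f)) = (1 / norm f) * norm (slice j f)" for j
        by (simp add: slice_simps norm_scaleC_ell2 c_def norm_divide)
      then have "?N (\<lambda>j. slice j (c *\<^sub>C f)) = (1 / norm f) * ?N (\<lambda>j. slice j f)"
        by (simp only: L2_set_scale[of "1 / norm f"] zero_le_divide_1_iff norm_ge_zero)
      moreover have "?N (\<lambda>j. slice j f) \<le> norm f"
        unfolding L2_set_def by (intro real_le_lsqrt sum_norm_slice_le) (auto simp: sum_nonneg)
      ultimately have "?N (\<lambda>j. slice j (c *\<^sub>C f)) \<le> 1"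
        using False by (simp add: divide_le_eq_1)
      from sup[OF this] have "norm (block n x \<cdot> (c *\<^sub>C f)) \<le> matrix_norm n x"
        by (simp add: norm_block_apply)
      then show ?thesis
        using False by (simp add: bop_scaleC norm_scaleC_ell2 c_def norm_divide field_simps)
    qed simp
  qed
qed

lemma matrix_norm_apply:
  "L2_set (\<lambda>i. norm (\<Sum>j<n. x i j \<cdot> h j)) {..<n} \<le> matrix_norm n x * L2_set (\<lambda>j. norm (h j)) {..<n}"
  unfolding matrix_norm_eq_norm_block by (rule L2_set_block)

lemma matrix_norm_nonneg: "0 \<le> matrix_norm n x"
  by (simp add: matrix_norm_eq_norm_block)

lemma matrix_norm_leI:
  assumes "0 \<le> B"
    and "\<And>h. L2_set (\<lambda>i. norm (\<Sum>j<n. x i j \<cdot> h j)) {..<n} \<le> B * L2_set (\<lambda>j. norm (h j)) {..<n}"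
  shows "matrix_norm n x \<le> B"
  unfolding matrix_norm_eq_norm_block
proof (rule norm_bop_leI[OF assms(1)])
  fix f :: "('a \<times> nat) ell2"
  have "L2_set (\<lambda>j. norm (slice j f)) {..<n} \<le> norm f"
    unfolding L2_set_def by (intro real_le_lsqrt sum_norm_slice_le) (auto simp: sum_nonneg)
  then show "norm (block n x \<cdot> f) \<le> B * norm f"
    unfolding norm_block_apply
    by (rule order_trans[OF assms(2)[of "\<lambda>j. slice j f"] mult_left_mono[OF _ assms(1)]])
qed

lemma matrix_norm_1: "matrix_norm 1 (\<lambda>i j. x) = norm x"
proof (rule antisym)
  show "matrix_norm 1 (\<lambda>i j. x) \<le> norm x"
    by (rule matrix_norm_leI) (simp_all add: L2_set_def norm_bop_apply)
  show "norm x \<le> matrix_norm 1 (\<lambda>i j. x)"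
  proof (rule norm_bop_leI[OF matrix_norm_nonneg])
    show "norm (x \<cdot> f) \<le> matrix_norm 1 (\<lambda>i j. x) * norm f" for f
      using matrix_norm_apply[where n = 1 and x = "\<lambda>i j. x" and h = "\<lambda>j. f"] by (simp add: L2_set_def)
  qed
qed

lemma bounded_linear_block:
  assumes "\<And>i j. bounded_linear (x i j)"
  shows "bounded_linear (\<lambda>Y. block n (\<lambda>i j. x i j Y))"
  unfolding block_def
  by (intro bounded_linear_sum bounded_linear_compose[OF bounded_linear_corner[OF inj_leg inj_leg]]
      assms)

lemma has_sum_finite_sum:
  fixes f :: "'a \<Rightarrow> 'b \<Rightarrow> real"
  assumes "\<And>i. i \<in> F \<Longrightarrow> (f i has_sum s i) A"
  shows "((\<lambda>k. \<Sum>i\<in>F. f i k) has_sum (\<Sum>i\<in>F. s i)) A"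
  using assms by (induction F rule: infinite_finite_induct) (auto intro!: has_sum_add)

text \<open>The Hilbert space norm of \<open>f\<close> is the square sum of the norms of its slices, on each of which
  \<open>ampl x\<close> acts as \<open>x\<close>.\<close>

lemma matrix_norm_ampl_le:
  "matrix_norm n (\<lambda>i j. ampl (x i j) :: ('i \<times> 'k) bop) \<le> matrix_norm n x"
proof (rule matrix_norm_leI[OF matrix_norm_nonneg])
  fix h :: "nat \<Rightarrow> ('i \<times> 'k) ell2"
  let ?M = "matrix_norm n x"
  have out: "((\<lambda>k. \<Sum>i<n. (norm (slice k (\<Sum>j<n. ampl (x i j) \<cdot> h j)))\<^sup>2) has_sum
      (\<Sum>i<n. (norm (\<Sum>j<n. ampl (x i j) \<cdot> h j))\<^sup>2)) UNIV"
    by (intro has_sum_finite_sum has_sum_norm_slice)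
  have inp: "((\<lambda>k. ?M\<^sup>2 * (\<Sum>j<n. (norm (slice k (h j)))\<^sup>2)) has_sum
      ?M\<^sup>2 * (\<Sum>j<n. (norm (h j))\<^sup>2)) UNIV"
    by (intro has_sum_cmult_right has_sum_finite_sum has_sum_norm_slice)
  have "(\<Sum>i<n. (norm (slice k (\<Sum>j<n. ampl (x i j) \<cdot> h j)))\<^sup>2)
      \<le> ?M\<^sup>2 * (\<Sum>j<n. (norm (slice k (h j)))\<^sup>2)" for k
    using power_mono[OF matrix_norm_apply[where n = n and x = x and h = "\<lambda>j. slice k (h j)"] L2_set_nonneg, of 2]
    by (simp add: slice_sum slice_ampl L2_set_def sum_nonneg power_mult_distrib)
  from has_sum_mono[OF out inp this]
  have "(\<Sum>i<n. (norm (\<Sum>j<n. ampl (x i j) \<cdot> h j))\<^sup>2) \<le> (?M * L2_set (\<lambda>j. norm (h j)) {..<n})\<^sup>2"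
    by (simp add: power_mult_distrib L2_set_def sum_nonneg)
  then show "L2_set (\<lambda>i. norm (\<Sum>j<n. ampl (x i j) \<cdot> h j)) {..<n}
      \<le> ?M * L2_set (\<lambda>j. norm (h j)) {..<n}"
    unfolding L2_set_def[of "\<lambda>i. norm (\<Sum>j<n. ampl (x i j) \<cdot> h j)"]
    by (intro real_le_lsqrt) (auto simp: sum_nonneg matrix_norm_nonneg)
qed

lemma norm_ampl_le: "norm (ampl x) \<le> norm x"
  using matrix_norm_ampl_le[of 1 "\<lambda>i j. x"] by (simp only: matrix_norm_1)

lemma bounded_linear_ampl: "bounded_linear ampl"
  by (rule bounded_linear_intro[of _ 1])
    (simp_all add: ampl_add ampl_scaleC scaleR_scaleC norm_ampl_le)

text \<open>The matrices over a C*-algebra form a C*-algebra of operators, on which a star homomorphism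
  acts entrywise as a star homomorphism; so contractivity implies complete contractivity.\<close>

theorem star_hom_completely_contractive:
  fixes S :: "'i bop set" and \<rho> :: "'i bop \<Rightarrow> 'j bop"
  assumes S: "cstar_algebra S" and \<rho>: "star_hom_on S \<rho>"
    and x: "\<And>i j. i < n \<Longrightarrow> j < n \<Longrightarrow> x i j \<in> S"
  shows "matrix_norm n (\<lambda>i j. \<rho> (x i j)) \<le> matrix_norm n x"
proof -
  have alg: "closed_algebra S" and sub: "csubspace S" and \<rho>lin: "clinear_on S \<rho>"
    using S \<rho> by (auto dest: cstar_algebraD closed_algebraD star_hom_onD alg_hom_onD)
  \<comment> \<open>These are the \<open>block n y\<close> with entries in \<open>S\<close>, described by conditions that are visibly closed.\<close>
  define M where "M = {Y. Y = block n (\<lambda>i j. entry i j Y) \<and> (\<forall>i<n. \<forall>j<n. entry i j Y \<in> S)}"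
  define \<rho>M where "\<rho>M Y = block n (\<lambda>i j. \<rho> (entry i j Y))" for Y :: "('i \<times> nat) bop"
  have block_M: "block n y \<in> M" if "\<And>i j. i < n \<Longrightarrow> j < n \<Longrightarrow> y i j \<in> S" for y
    unfolding M_def using that by (auto simp: entry_block intro!: block_cong)
  have M_block: "\<exists>y. Y = block n y \<and> (\<forall>i<n. \<forall>j<n. y i j \<in> S)" if "Y \<in> M" for Y
    using that unfolding M_def by blast
  have \<rho>M_block: "\<rho>M (block n y) = block n (\<lambda>i j. \<rho> (y i j))" for y
    unfolding \<rho>M_def by (rule block_cong) (simp add: entry_block)
  have "closed M"
  proof -
    have "M = {Y. Y = block n (\<lambda>i j. entry i j Y)} \<inter> (\<Inter>i\<in>{..<n}. \<Inter>j\<in>{..<n}. entry i j -` S)"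
      unfolding M_def by auto
    moreover have "closed {Y :: ('i \<times> nat) bop. Y = block n (\<lambda>i j. entry i j Y)}"
      by (intro closed_Collect_eq continuous_on_id linear_continuous_on bounded_linear_block
          bounded_linear_entry)
    moreover have "closed (entry i j -` S)" for i j
      by (intro closed_vimage closed_algebraD(3)[OF alg] linear_continuous_on bounded_linear_entry)
    ultimately show ?thesis
      by (auto intro!: closed_Int closed_INT)
  qed
  moreover have "csubspace M"
    unfolding csubspace_def
  proof (intro conjI ballI allI)
    have "block n (\<lambda>i j. 0 :: 'i bop) = 0"
      using block_scaleC[of 0 n "\<lambda>i j. 0 :: 'i bop"] block_add[of n "\<lambda>i j. 0 :: 'i bop" "\<lambda>i j. 0"]
      by simp
    then show "0 \<in> M"
      using block_M[of "\<lambda>i j. 0"] csubspaceD(1)[OF sub] by simp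
    show "X + Y \<in> M" if "X \<in> M" "Y \<in> M" for X Y
      using M_block[OF that(1)] M_block[OF that(2)]
      by (auto simp: block_add intro!: block_M csubspaceD(2)[OF sub])
    show "c *\<^sub>C X \<in> M" if "X \<in> M" for c X
      using M_block[OF that] by (auto simp: block_scaleC intro!: block_M csubspaceD(3)[OF sub])
  qed
  moreover have "X * Y \<in> M" if "X \<in> M" "Y \<in> M" for X Y
    using M_block[OF that(1)] M_block[OF that(2)]
    by (auto simp: block_mult intro!: block_M csubspace_sum[OF sub] closed_algebraD(2)[OF alg])
  moreover have "adj X \<in> M" if "X \<in> M" for X
    using M_block[OF that] by (auto simp: adj_block intro!: block_M cstar_algebraD(2)[OF S])
  ultimately have "cstar_algebra M"
    by (simp add: cstar_algebra_def closed_algebra_def)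
  moreover have "star_hom_on M \<rho>M"
    unfolding star_hom_on_def alg_hom_on_def clinear_on_def mult_on_def
  proof (intro conjI ballI allI)
    fix X Y c assume X: "X \<in> M" and Y: "Y \<in> M"
    obtain a where a: "X = block n a" "\<And>i j. i < n \<Longrightarrow> j < n \<Longrightarrow> a i j \<in> S"
      using M_block[OF X] by blast
    obtain b where b: "Y = block n b" "\<And>i j. i < n \<Longrightarrow> j < n \<Longrightarrow> b i j \<in> S"
      using M_block[OF Y] by blast
    show "\<rho>M (X + Y) = \<rho>M X + \<rho>M Y"
      unfolding a(1) b(1) block_add \<rho>M_block
      by (rule block_cong) (simp add: clinear_onD(1)[OF \<rho>lin] a(2) b(2))
    show "\<rho>M (X * Y) = \<rho>M X * \<rho>M Y"
      unfolding a(1) b(1) block_mult \<rho>M_block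
    proof (rule block_cong)
      fix i j assume ij: "i < n" "j < n"
      then have "\<rho> (\<Sum>k<n. a i k * b k j) = (\<Sum>k<n. \<rho> (a i k * b k j))"
        by (intro clinear_on_sum[OF \<rho>lin sub] closed_algebraD(2)[OF alg] a(2) b(2)) auto
      also have "\<dots> = (\<Sum>k<n. \<rho> (a i k) * \<rho> (b k j))"
        using ij by (intro sum.cong alg_hom_onD(2)[OF star_hom_onD(1)[OF \<rho>]] a(2) b(2)) auto
      finally show "\<rho> (\<Sum>k<n. a i k * b k j) = (\<Sum>k<n. \<rho> (a i k) * \<rho> (b k j))" .
    qed
    show "\<rho>M (c *\<^sub>C X) = c *\<^sub>C \<rho>M X"
      unfolding a(1) block_scaleC \<rho>M_block
      by (rule block_cong) (simp add: clinear_onD(2)[OF \<rho>lin] a(2))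
    show "\<rho>M (adj X) = adj (\<rho>M X)"
      unfolding a(1) adj_block \<rho>M_block
      by (rule block_cong) (simp add: star_hom_onD(2)[OF \<rho>] a(2))
  qed
  ultimately have "norm (\<rho>M (block n x)) \<le> norm (block n x)"
    by (rule star_hom_contractive) (rule block_M[OF x])
  then show ?thesis
    by (simp add: \<rho>M_block matrix_norm_eq_norm_block)
qed

section \<open>The Poisson kernel of a row of partial isometries\<close>

lemma polarization:
  fixes K :: "'i ell2 \<Rightarrow> 'j ell2" and L :: "'i ell2 \<Rightarrow> 'k ell2"
  assumes K: "\<And>x y. K (x + y) = K x + K y" "\<And>c x. K (c *\<^sub>C x) = c *\<^sub>C K x"
    and L: "\<And>x y. L (x + y) = L x + L y" "\<And>c x. L (c *\<^sub>C x) = c *\<^sub>C L x"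
    and norm: "\<And>x. norm (K x) = norm (L x)"
  shows "cinner (K x) (K y) = cinner (L x) (L y)"
proof -
  have re: "inner (K x) (K y) = inner (L x) (L y)" for x y
    using norm[of "x + y"] norm[of x] norm[of y]
    by (simp add: K(1) L(1) norm_eq_sqrt_inner inner_add_left inner_add_right inner_commute)
  have "inner (K x) (K (\<i> *\<^sub>C y)) = inner (L x) (L (\<i> *\<^sub>C y))"
    by (rule re)
  then have "Im (cinner (K x) (K y)) = Im (cinner (L x) (L y))"
    by (simp add: K(2) L(2) inner_ell2_def cinner_scaleC_right)
  with re[of x y] show ?thesis
    by (simp add: inner_ell2_def complex_eq_iff)
qed

lemma has_sum_exhaustion:
  fixes f :: "'a \<Rightarrow> real"
  assumes nonneg: "\<And>x. 0 \<le> f x" and fin: "\<And>N. finite (A N)"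
    and exh: "\<And>F. finite F \<Longrightarrow> \<exists>N. F \<subseteq> A N"
    and le: "\<And>N :: nat. sum f (A N) \<le> L" and lim: "(\<lambda>N. sum f (A N)) \<longlonglongrightarrow> L"
  shows "(f has_sum L) UNIV"
proof -
  have bound: "sum f F \<le> L" if F: "finite F" for F
  proof -
    obtain N where "F \<subseteq> A N"
      using exh[OF F] by blast
    then have "sum f F \<le> sum f (A N)"
      using fin nonneg by (intro sum_mono2) auto
    then show ?thesis
      using le[of N] by linarith
  qed
  have summable: "f summable_on UNIV"
    using bound nonneg by (intro nonneg_bdd_above_summable_on) (auto intro!: bdd_aboveI)
  have "L \<le> infsum f UNIV"
    by (rule LIMSEQ_le_const2[OF lim])
      (use fin nonneg in \<open>auto intro!: finite_sum_le_infsum[OF summable] exI[of _ 0]\<close>)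
  moreover have "infsum f UNIV \<le> L"
    using bound by (intro infsum_le_finite_sums summable) auto
  ultimately show ?thesis
    using has_sum_infsum[OF summable] by simp
qed

lemma sum_lists_Suc:
  fixes f :: "'d::finite list \<Rightarrow> real"
  shows "(\<Sum>\<mu> | length \<mu> = Suc n. f \<mu>) = (\<Sum>\<mu> | length \<mu> = n. \<Sum>i\<in>UNIV. f (\<mu> @ [i]))"
proof -
  have bij: "bij_betw (\<lambda>(\<mu>, i). \<mu> @ [i]) ({\<mu>. length \<mu> = n} \<times> (UNIV :: 'd set))
      {\<mu>. length \<mu> = Suc n}"
    unfolding bij_betw_def
  proof
    show "(\<lambda>(\<mu>, i). \<mu> @ [i]) ` ({\<mu>. length \<mu> = n} \<times> (UNIV :: 'd set)) = {\<mu>. length \<mu> = Suc n}"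
    proof safe
      fix \<mu> :: "'d list" assume len: "length \<mu> = Suc n"
      then have "\<mu> = butlast \<mu> @ [last \<mu>]"
        by (metis append_butlast_last_id list.size(3) nat.distinct(1))
      with len show "\<mu> \<in> (\<lambda>(\<mu>, i). \<mu> @ [i]) ` ({\<mu>. length \<mu> = n} \<times> UNIV)"
        by (intro image_eqI[of _ _ "(butlast \<mu>, last \<mu>)"]) auto
    qed auto
  qed (auto simp: inj_on_def)
  show ?thesis
    by (simp add: sum.reindex_bij_betw[OF bij, of f, symmetric] sum.cartesian_product
        case_prod_unfold)
qed

text \<open>The relations satisfied by the images of the generators in a Toeplitz representation: \<open>q\<close> is
  the image of the identity, and the \<open>S i\<close> are partial isometries with orthogonal ranges.\<close>

locale orthogonal_partial_isometries =
  fixes S :: "'d::finite \<Rightarrow> 'h bop" and q :: "'h bop"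
  assumes q_idem: "q * q = q" and q_adj: "adj q = q"
    and q_S: "q * S i = S i" and S_q: "S i * q = S i"
    and orth: "i \<noteq> j \<Longrightarrow> adj (S i) * S j = 0"
    and partial_isometry: "S i * adj (S i) * S i = S i"
begin

text \<open>The empty word gives \<open>q\<close> instead of \<open>1\<close>, so that the product over any word vanishes off the
  range of \<open>q\<close>, on which the represented algebra is unital.\<close>

primrec word_op :: "'d list \<Rightarrow> 'h bop" where
  "word_op [] = q"
| "word_op (i # \<mu>) = S i * word_op \<mu>"

lemma q_word_op: "q * word_op \<mu> = word_op \<mu>"
  by (cases \<mu>) (simp_all add: q_idem q_S flip: mult.assoc)

lemma word_op_snoc: "word_op (\<mu> @ [i]) = word_op \<mu> * S i"
  by (induction \<mu>) (simp_all add: q_S S_q mult.assoc)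

definition range_proj :: "'h bop" where
  "range_proj = (\<Sum>i\<in>UNIV. S i * adj (S i))"

lemma range_proj_S: "range_proj * S j = S j"
proof -
  have "range_proj * S j = (\<Sum>i\<in>UNIV. if i = j then S j else 0)"
    unfolding range_proj_def sum_distrib_right
    by (intro sum.cong refl) (use orth partial_isometry in \<open>auto simp: mult.assoc\<close>)
  then show ?thesis
    by simp
qed

lemma range_proj_idem: "range_proj * range_proj = range_proj"
proof -
  have "range_proj * range_proj = (\<Sum>i\<in>UNIV. range_proj * S i * adj (S i))"
    by (subst (2) range_proj_def) (simp add: sum_distrib_left mult.assoc)
  then show ?thesis
    by (simp add: range_proj_S flip: range_proj_def)
qed

lemma adj_range_proj: "adj range_proj = range_proj"
  by (simp add: range_proj_def adj_sum adj_mult)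

lemma inner_range_proj: "inner h (range_proj \<cdot> h) = (norm (range_proj \<cdot> h))\<^sup>2"
proof -
  have "cinner h (range_proj \<cdot> h) = cinner (range_proj \<cdot> h) (range_proj \<cdot> h)"
    by (metis adj_range_proj cinner_adj range_proj_idem bop_simps(4))
  then show ?thesis
    by (simp add: inner_ell2_def cinner_norm)
qed

lemma sum_norm_adj_S: "(\<Sum>i\<in>UNIV. (norm (adj (S i) \<cdot> h))\<^sup>2) = (norm (range_proj \<cdot> h))\<^sup>2"
proof -
  have "inner h (range_proj \<cdot> h) = (\<Sum>i\<in>UNIV. inner h ((S i * adj (S i)) \<cdot> h))"
    by (simp add: range_proj_def bop_sum_apply inner_sum_right)
  also have "\<dots> = (\<Sum>i\<in>UNIV. (norm (adj (S i) \<cdot> h))\<^sup>2)"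
  proof (rule sum.cong)
    fix i
    have "cinner h ((S i * adj (S i)) \<cdot> h) = cinner (adj (S i) \<cdot> h) (adj (S i) \<cdot> h)"
      by (simp add: bop_simps cinner_adj)
    then show "inner h ((S i * adj (S i)) \<cdot> h) = (norm (adj (S i) \<cdot> h))\<^sup>2"
      by (simp add: inner_ell2_def cinner_norm)
  qed simp
  finally show ?thesis
    by (simp add: inner_range_proj)
qed

lemma norm_range_proj_complement:
  "(norm (h - range_proj \<cdot> h))\<^sup>2 = (norm h)\<^sup>2 - (norm (range_proj \<cdot> h))\<^sup>2"
  using inner_range_proj[of h]
  by (simp add: power2_norm_eq_inner inner_diff_left inner_diff_right inner_commute)

text \<open>The square root of \<open>1 - r\<^sup>2 \<cdot> range_proj\<close>.\<close>

definition defect :: "real \<Rightarrow> 'h bop" where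
  "defect r = (1 - range_proj) + complex_of_real (sqrt (1 - r\<^sup>2)) *\<^sub>C range_proj"

lemma norm_defect:
  assumes "0 \<le> r" "r \<le> 1"
  shows "(norm (defect r \<cdot> h))\<^sup>2 = (norm h)\<^sup>2 - r\<^sup>2 * (\<Sum>i\<in>UNIV. (norm (adj (S i) \<cdot> h))\<^sup>2)"
proof -
  let ?p = "range_proj \<cdot> h"
  have s: "(sqrt (1 - r\<^sup>2))\<^sup>2 = 1 - r\<^sup>2"
    using assms by (simp add: power_le_one)
  have "defect r \<cdot> h = (h - ?p) + sqrt (1 - r\<^sup>2) *\<^sub>R ?p"
    by (simp add: defect_def bop_simps scaleR_scaleC)
  moreover have "inner (h - ?p) ?p = 0"
    using inner_range_proj[of h] by (simp add: inner_diff_left power2_norm_eq_inner)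
  ultimately have "(norm (defect r \<cdot> h))\<^sup>2
      = (norm (h - ?p))\<^sup>2 + (norm (sqrt (1 - r\<^sup>2) *\<^sub>R ?p))\<^sup>2"
    by (simp only:) (rule norm_add_Pythagorean, simp add: orthogonal_def)
  also have "(norm (sqrt (1 - r\<^sup>2) *\<^sub>R ?p))\<^sup>2 = (sqrt (1 - r\<^sup>2))\<^sup>2 * (norm ?p)\<^sup>2"
    by (simp only: norm_scaleR power_mult_distrib power2_abs)
  finally have "(norm (defect r \<cdot> h))\<^sup>2 = (norm (h - ?p))\<^sup>2 + (sqrt (1 - r\<^sup>2))\<^sup>2 * (norm ?p)\<^sup>2" .
  then show ?thesis
    by (simp add: norm_range_proj_complement s sum_norm_adj_S algebra_simps)
qed

definition level :: "'h ell2 \<Rightarrow> nat \<Rightarrow> real" where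
  "level h n = (\<Sum>\<mu> | length \<mu> = n. (norm (adj (word_op \<mu>) \<cdot> h))\<^sup>2)"

lemma level_Suc:
  "level h (Suc n) = (\<Sum>\<mu> | length \<mu> = n. \<Sum>i\<in>UNIV. (norm (adj (S i) \<cdot> adj (word_op \<mu>) \<cdot> h))\<^sup>2)"
  by (simp add: level_def sum_lists_Suc word_op_snoc adj_mult bop_simps)

lemma level_0: "level h 0 = (norm (q \<cdot> h))\<^sup>2"
  by (simp add: level_def q_adj)

lemma level_le: "level h n \<le> level h 0"
proof (induction n)
  case (Suc n)
  have "level h (Suc n) \<le> level h n"
    unfolding level_Suc unfolding level_def
  proof (rule sum_mono)
    fix \<mu>
    show "(\<Sum>i\<in>UNIV. (norm (adj (S i) \<cdot> adj (word_op \<mu>) \<cdot> h))\<^sup>2)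
        \<le> (norm (adj (word_op \<mu>) \<cdot> h))\<^sup>2"
      using norm_range_proj_complement[of "adj (word_op \<mu>) \<cdot> h"]
        zero_le_power2[of "norm (adj (word_op \<mu>) \<cdot> h - range_proj \<cdot> adj (word_op \<mu>) \<cdot> h)"]
      unfolding sum_norm_adj_S by linarith
  qed
  with Suc show ?case
    by simp
qed simp

definition kernel_coeff :: "real \<Rightarrow> 'd list \<Rightarrow> 'h ell2 \<Rightarrow> 'h ell2" where
  "kernel_coeff r \<mu> h = complex_of_real (r ^ length \<mu>) *\<^sub>C (defect r \<cdot> adj (word_op \<mu>) \<cdot> h)"

text \<open>By the choice of the defect operator the sum over the words of length \<open>n\<close> is
  \<open>r ^ (2 * n) * level h n - r ^ (2 * Suc n) * level h (Suc n)\<close>, so the sum telescopes; the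
  factor \<open>r < 1\<close> kills the remainder.\<close>

lemma has_sum_kernel_coeff:
  assumes r: "0 \<le> r" "r < 1"
  shows "((\<lambda>\<mu>. (norm (kernel_coeff r \<mu> h))\<^sup>2) has_sum (norm (q \<cdot> h))\<^sup>2) UNIV"
proof (rule has_sum_exhaustion[where A = "\<lambda>N. {\<mu>. length \<mu> < N}"])
  let ?f = "\<lambda>\<mu>. (norm (kernel_coeff r \<mu> h))\<^sup>2"
  let ?l = "\<lambda>n. (r\<^sup>2) ^ n * level h n"
  have fin: "finite {\<mu> :: 'd list. length \<mu> = n}" for n
    using finite_lists_length_eq[of "UNIV :: 'd set" n] by simp
  have layer: "(\<Sum>\<mu> | length \<mu> = n. ?f \<mu>) = ?l n - ?l (Suc n)" for n
  proof -
    have "?f \<mu> = (r\<^sup>2) ^ n * ((norm (adj (word_op \<mu>) \<cdot> h))\<^sup>2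
        - r\<^sup>2 * (\<Sum>i\<in>UNIV. (norm (adj (S i) \<cdot> adj (word_op \<mu>) \<cdot> h))\<^sup>2))"
      if "length \<mu> = n" for \<mu>
      using r that by (simp add: kernel_coeff_def norm_scaleC_ell2 power_mult_distrib norm_defect
          norm_power power_mult[symmetric] mult.commute)
    then have "(\<Sum>\<mu> | length \<mu> = n. ?f \<mu>) = (\<Sum>\<mu> | length \<mu> = n. (r\<^sup>2) ^ n *
        ((norm (adj (word_op \<mu>) \<cdot> h))\<^sup>2
          - r\<^sup>2 * (\<Sum>i\<in>UNIV. (norm (adj (S i) \<cdot> adj (word_op \<mu>) \<cdot> h))\<^sup>2)))"
      by (intro sum.cong) auto
    also have "\<dots> = (r\<^sup>2) ^ n * (level h n - r\<^sup>2 * level h (Suc n))"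
      unfolding sum_distrib_left[symmetric] sum_subtractf level_Suc level_def[of h n] ..
    finally show ?thesis
      by (simp add: algebra_simps)
  qed
  have fin_less: "finite {\<mu> :: 'd list. length \<mu> < N}" for N
  proof (rule finite_subset)
    show "{\<mu> :: 'd list. length \<mu> < N} \<subseteq> (\<Union>n<N. {\<mu>. length \<mu> = n})"
      by auto
  qed (auto simp: fin)
  have partial: "sum ?f {\<mu>. length \<mu> < N} = level h 0 - ?l N" for N
  proof (induction N)
    case (Suc N)
    have "{\<mu> :: 'd list. length \<mu> < Suc N} = {\<mu>. length \<mu> < N} \<union> {\<mu>. length \<mu> = N}"
      by auto
    then have "sum ?f {\<mu>. length \<mu> < Suc N}
        = sum ?f {\<mu>. length \<mu> < N} + sum ?f {\<mu>. length \<mu> = N}"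
      using fin fin_less by (simp only:) (intro sum.union_disjoint; auto)
    then show ?case
      using Suc layer[of N] by simp
  qed simp
  have level_nonneg: "0 \<le> level h n" for n
    by (simp add: level_def sum_nonneg)
  show "finite {\<mu> :: 'd list. length \<mu> < N}" for N
    by (rule fin_less)
  show "\<exists>N. F \<subseteq> {\<mu>. length \<mu> < N}" if "finite F" for F :: "'d list set"
    using finite_nat_set_iff_bounded[of "length ` F"] that by auto
  show "sum ?f {\<mu>. length \<mu> < N} \<le> (norm (q \<cdot> h))\<^sup>2" for N
    using level_nonneg[of N] by (simp add: partial level_0)
  have "?l \<longlonglongrightarrow> 0"
  proof (rule Lim_null_comparison)
    show "\<forall>\<^sub>F n in sequentially. norm (?l n) \<le> (r\<^sup>2) ^ n * level h 0"
      using level_le level_nonneg by (intro always_eventually allI) (simp add: mult_left_mono)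
    have "r\<^sup>2 < 1"
      using r power_strict_mono[of r 1 2] by simp
    then show "(\<lambda>n. (r\<^sup>2) ^ n * level h 0) \<longlonglongrightarrow> 0"
      by (intro tendsto_mult_left_zero LIMSEQ_power_zero) simp
  qed
  from tendsto_diff[OF tendsto_const[of "level h 0"] this]
  show "(\<lambda>N. sum ?f {\<mu>. length \<mu> < N}) \<longlonglongrightarrow> (norm (q \<cdot> h))\<^sup>2"
    by (simp add: partial level_0)
qed simp

text \<open>The Poisson kernel, whose component at the word \<open>\<mu>\<close> is \<open>kernel_coeff r \<mu> h\<close>.\<close>

definition kernel :: "real \<Rightarrow> 'h ell2 \<Rightarrow> ('d list \<times> 'h) ell2" where
  "kernel r h = Abs_ell2 (\<lambda>(\<mu>, k). ell2_apply (kernel_coeff r \<mu> h) k)"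

context
  fixes r :: real
  assumes r: "0 \<le> r" "r < 1"
begin

lemma has_sum_kernel:
  "((\<lambda>p. (cmod ((\<lambda>(\<mu>, k). ell2_apply (kernel_coeff r \<mu> h) k) p))\<^sup>2)
    has_sum (norm (q \<cdot> h))\<^sup>2) UNIV"
proof -
  let ?f = "\<lambda>p. (cmod ((\<lambda>(\<mu>, k). ell2_apply (kernel_coeff r \<mu> h) k) p))\<^sup>2"
  note coeff = has_sum_kernel_coeff[OF r, of h]
  have inner: "((\<lambda>k. ?f (\<mu>, k)) has_sum (norm (kernel_coeff r \<mu> h))\<^sup>2) UNIV" for \<mu>
    using has_sum_norm_ell2[of "kernel_coeff r \<mu> h"] by simp
  have "?f summable_on Sigma UNIV (\<lambda>_. UNIV)"
    by (rule summable_on_SigmaI[OF inner]) (use coeff in \<open>auto simp: summable_on_def\<close>)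
  from has_sum_SigmaI[OF inner coeff this] show ?thesis
    by simp
qed

lemma ell2_apply_kernel: "ell2_apply (kernel r h) (\<mu>, k) = ell2_apply (kernel_coeff r \<mu> h) k"
proof -
  have "square_summable (\<lambda>(\<mu>, k). ell2_apply (kernel_coeff r \<mu> h) k)"
    using has_sum_kernel[of h] unfolding square_summable_def summable_on_def by blast
  then show ?thesis
    by (simp add: kernel_def Abs_ell2_inverse)
qed

lemma norm_kernel: "norm (kernel r h) = norm (q \<cdot> h)"
proof -
  have "ell2_apply (kernel r h) = (\<lambda>(\<mu>, k). ell2_apply (kernel_coeff r \<mu> h) k)"
    by (auto simp: ell2_apply_kernel)
  then have "((\<lambda>p. (cmod (ell2_apply (kernel r h) p))\<^sup>2) has_sum (norm (q \<cdot> h))\<^sup>2) UNIV"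
    using has_sum_kernel[of h] by (simp only:)
  then have "(norm (kernel r h))\<^sup>2 = (norm (q \<cdot> h))\<^sup>2"
    using has_sum_norm_ell2 has_sum_unique by blast
  then show ?thesis
    by simp
qed

lemma kernel_add: "kernel r (h + g) = kernel r h + kernel r g"
  by (rule ell2_eqI)
    (auto simp: ell2_apply_kernel kernel_coeff_def plus_ell2.rep_eq blinfun.add_right
      scaleC_add_right split: prod.split)

lemma kernel_scaleC: "kernel r (c *\<^sub>C h) = c *\<^sub>C kernel r h"
  by (rule ell2_eqI)
    (auto simp: ell2_apply_kernel kernel_coeff_def scaleC_ell2.rep_eq bop_scaleC)

lemma kernel_q: "kernel r (q \<cdot> h) = kernel r h"
proof -
  have "adj (word_op \<mu>) \<cdot> q \<cdot> h = adj (word_op \<mu>) \<cdot> h" for \<mu>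
    using arg_cong[OF q_word_op[of \<mu>], of adj] by (metis adj_mult q_adj bop_simps(4))
  then show ?thesis
    by (intro ell2_eqI) (auto simp: ell2_apply_kernel kernel_coeff_def)
qed

end

context
  fixes r :: real and J :: "'d ncpoly set"
  assumes r: "0 \<le> r" "r < 1"
    and vanish: "\<And>\<mu>. \<mu> \<notin> allowed_words J \<Longrightarrow> word_op \<mu> = 0"
begin

lemma slice_kernel: "ell2_apply (slice k (kernel r h)) \<mu> = ell2_apply (kernel_coeff r \<mu> h) k"
  by (simp add: ell2_apply_slice ell2_apply_kernel[OF r])

lemma kernel_coeff_vanish: "\<mu> \<notin> allowed_words J \<Longrightarrow> kernel_coeff r \<mu> h = 0"
  by (simp add: kernel_coeff_def vanish bop_simps)

lemma ampl_adj_fock_one_kernel: "ampl (adj (fock_one J)) \<cdot> kernel r h = kernel r h"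
proof (rule ell2_eqI)
  fix p :: "'d list \<times> 'h"
  obtain \<mu> k where p: "p = (\<mu>, k)"
    by (cases p)
  show "ell2_apply (ampl (adj (fock_one J)) \<cdot> kernel r h) p = ell2_apply (kernel r h) p"
    by (simp add: p ell2_apply_ampl_adj fock_one_ket cinner_ket slice_kernel
        ell2_apply_kernel[OF r] kernel_coeff_vanish zero_ell2.rep_eq)
qed

text \<open>Here the vanishing of \<open>word_op\<close> on the words of the ideal compensates for the
  truncation in the definition of the creation operators.\<close>

lemma ampl_adj_creation_kernel:
  "ampl (adj (creation J i)) \<cdot> kernel r h = kernel r (complex_of_real r *\<^sub>C (adj (S i) \<cdot> h))"
proof (rule ell2_eqI)
  fix p :: "'d list \<times> 'h"
  obtain \<mu> k where p: "p = (\<mu>, k)"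
    by (cases p)
  have shift: "kernel_coeff r (i # \<mu>) h = kernel_coeff r \<mu> (complex_of_real r *\<^sub>C (adj (S i) \<cdot> h))"
    by (simp add: kernel_coeff_def adj_mult bop_simps bop_scaleC scaleC_scaleC mult.commute)
  have "kernel_coeff r (i # \<mu>) h = 0" if "\<mu> \<notin> allowed_words J"
    using vanish[OF that] by (simp add: kernel_coeff_def bop_simps)
  then show "ell2_apply (ampl (adj (creation J i)) \<cdot> kernel r h) p
      = ell2_apply (kernel r (complex_of_real r *\<^sub>C (adj (S i) \<cdot> h))) p"
    by (auto simp: p ell2_apply_ampl_adj creation_ket cinner_ket slice_kernel
        ell2_apply_kernel[OF r] kernel_coeff_vanish shift[symmetric] zero_ell2.rep_eq)
qed

text \<open>With \<open>K\<close> the Poisson kernel, \<open>\<Phi>(x) = K\<^sup>*(x \<otimes> 1)K\<close>. The range of \<open>K\<close> is invariant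
  under the adjoints of the \<open>x \<otimes> 1\<close> with \<open>x\<close> in the tensor algebra, i.e.
  \<open>K\<^sup>*(x \<otimes> 1) = \<Phi>(x)K\<^sup>*\<close>, which makes \<open>\<Phi>\<close> multiplicative there.\<close>

theorem poisson_transform:
  "\<exists>\<Phi>. alg_hom_on (tensor_algebra J) \<Phi> \<and>
     (\<forall>n x. matrix_norm n (\<lambda>i j. \<Phi> (x i j)) \<le> matrix_norm n x) \<and>
     \<Phi> (fock_one J) = q \<and> (\<forall>i. \<Phi> (creation J i) = complex_of_real r *\<^sub>C S i)"
proof -
  let ?K = "kernel r"
  have norm_q: "norm (q \<cdot> h) \<le> norm h" for h
  proof -
    have "(norm (q \<cdot> h))\<^sup>2 = cmod (cinner h (q \<cdot> h))"
      by (metis cinner_adj q_adj q_idem bop_simps(4) cinner_norm norm_of_real abs_power2)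
    also have "\<dots> \<le> norm h * norm (q \<cdot> h)"
      by (rule cmod_cinner_le)
    finally show ?thesis
      by (cases "norm (q \<cdot> h) = 0") (simp_all add: power2_eq_square)
  qed
  have norm_K: "norm (?K h) \<le> norm h" for h
    by (simp add: norm_kernel[OF r] norm_q)
  obtain K' where adjoint: "\<And>h f. cinner (K' f) h = cinner f (?K h)"
    and K'_add: "\<And>f g. K' (f + g) = K' f + K' g"
    and K'_scale: "\<And>c f. K' (c *\<^sub>C f) = c *\<^sub>C K' f"
    and K'_norm: "\<And>f. norm (K' f) \<le> norm f"
    by (rule adjoint_exists[of ?K])
      (auto simp: kernel_add[OF r] kernel_scaleC[OF r] norm_K)
  have eqI: "x = y" if "\<And>h. cinner x h = cinner y h" for x y :: "'h ell2"
    using that by (intro ell2_eqI) (metis cinner_ket cinner_commute)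
  have K'_sum: "K' (\<Sum>i\<in>F. f i) = (\<Sum>i\<in>F. K' (f i))" for F :: "nat set" and f
    using K'_scale[of 0 0]
    by (induction F rule: infinite_finite_induct) (simp_all add: K'_add, (metis K'_add add_cancel_right_left)+)
  have K'_bl: "bounded_linear K'"
    by (rule bounded_linear_intro[of _ 1]) (simp_all add: K'_add K'_scale scaleR_scaleC K'_norm)
  have K'K: "K' (?K h) = q \<cdot> h" for h
  proof (rule eqI)
    fix g
    have "cinner (?K h) (?K g) = cinner (q \<cdot> h) (q \<cdot> g)"
      by (rule polarization) (simp_all add: kernel_add[OF r] kernel_scaleC[OF r] norm_kernel[OF r]
          blinfun.add_right bop_scaleC)
    then show "cinner (K' (?K h)) g = cinner (q \<cdot> h) g"
      by (metis adjoint cinner_adj q_adj q_idem bop_simps(4))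
  qed
  have "\<exists>T. \<forall>h. T \<cdot> h = K' (ampl x \<cdot> ?K h)" for x :: "'d list bop"
  proof (rule bop_construct)
    show "norm (K' (ampl x \<cdot> ?K h)) \<le> norm h * norm x" for h
    proof -
      have "norm (K' (ampl x \<cdot> ?K h)) \<le> norm (ampl x :: ('d list \<times> 'h) bop) * norm (?K h)"
        using K'_norm norm_bop_apply by (rule order_trans)
      also have "\<dots> \<le> norm x * norm h"
        by (intro mult_mono norm_ampl_le norm_K) auto
      finally show ?thesis
        by (simp add: mult.commute)
    qed
  qed (simp_all add: kernel_add[OF r] kernel_scaleC[OF r] blinfun.add_right bop_scaleC K'_add
      K'_scale)
  then obtain \<Phi> where \<Phi>: "\<And>x h. \<Phi> x \<cdot> h = K' (ampl x \<cdot> ?K h)"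
    by metis
  have contractive: "matrix_norm n (\<lambda>i j. \<Phi> (x i j)) \<le> matrix_norm n x" for n x
  proof (rule matrix_norm_leI[OF matrix_norm_nonneg])
    fix h :: "nat \<Rightarrow> 'h ell2"
    let ?ax = "\<lambda>i j. ampl (x i j) :: ('d list \<times> 'h) bop"
    have "L2_set (\<lambda>i. norm (\<Sum>j<n. \<Phi> (x i j) \<cdot> h j)) {..<n}
        \<le> L2_set (\<lambda>i. norm (\<Sum>j<n. ?ax i j \<cdot> ?K (h j))) {..<n}"
      using K'_norm by (intro L2_set_mono) (simp_all add: \<Phi> flip: K'_sum)
    also have "\<dots> \<le> matrix_norm n ?ax * L2_set (\<lambda>j. norm (?K (h j))) {..<n}"
      by (rule matrix_norm_apply)
    also have "\<dots> \<le> matrix_norm n x * L2_set (\<lambda>j. norm (h j)) {..<n}"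
      by (intro mult_mono matrix_norm_ampl_le L2_set_mono norm_K matrix_norm_nonneg) auto
    finally show "L2_set (\<lambda>i. norm (\<Sum>j<n. \<Phi> (x i j) \<cdot> h j)) {..<n}
        \<le> matrix_norm n x * L2_set (\<lambda>j. norm (h j)) {..<n}" .
  qed
  have \<Phi>_norm: "norm (\<Phi> x) \<le> norm x" for x
    using contractive[of 1 "\<lambda>i j. x"] by (simp only: matrix_norm_1)
  have \<Phi>_add: "\<Phi> (x + y) = \<Phi> x + \<Phi> y" for x y
    by (rule bop_eqI) (simp add: \<Phi> bop_simps ampl_add K'_add)
  have \<Phi>_scale: "\<Phi> (c *\<^sub>C x) = c *\<^sub>C \<Phi> x" for c x
    by (rule bop_eqI) (simp add: \<Phi> bop_simps ampl_scaleC K'_scale)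
  have \<Phi>_bl: "bounded_linear \<Phi>"
    by (rule bounded_linear_intro[of _ 1]) (simp_all add: \<Phi>_add \<Phi>_scale scaleR_scaleC \<Phi>_norm)
  \<comment> \<open>The operators whose adjoint ampliations leave the range of the kernel invariant.\<close>
  define N where "N = {x. \<forall>f. K' (ampl x \<cdot> f) = \<Phi> x \<cdot> K' f}"
  have mult: "\<Phi> (x * y) = \<Phi> x * \<Phi> y" if "x \<in> N" for x y
    using that by (intro bop_eqI) (simp add: N_def \<Phi> ampl_mult bop_simps)
  have "closed_algebra N"
    unfolding closed_algebra_def csubspace_def
  proof (intro conjI ballI allI)
    have zero: "\<Phi> 0 = 0" "ampl 0 = (0 :: ('d list \<times> 'h) bop)" "K' 0 = 0"
      by (simp_all add: linear_0[OF bounded_linear.linear[OF \<Phi>_bl]]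
          linear_0[OF bounded_linear.linear[OF bounded_linear_ampl]]
          linear_0[OF bounded_linear.linear[OF K'_bl]])
    then show "0 \<in> N"
      by (simp add: N_def bop_simps)
    show "x + y \<in> N" "x * y \<in> N" if "x \<in> N" "y \<in> N" for x y
      using that by (simp_all add: N_def mult[OF that(1)] \<Phi>_add ampl_add ampl_mult bop_simps K'_add)
    show "c *\<^sub>C x \<in> N" if "x \<in> N" for c x
      using that by (simp add: N_def \<Phi>_scale ampl_scaleC bop_simps K'_scale)
    show "closed N"
      unfolding N_def
      by (intro closed_Collect_all closed_Collect_eq linear_continuous_on
          bounded_linear_compose[OF K'_bl bounded_linear_compose[OF bounded_linear_bop_eval
              bounded_linear_ampl]]
          bounded_linear_compose[OF bounded_linear_bop_eval \<Phi>_bl])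
  qed
  moreover have one: "K' (ampl (fock_one J) \<cdot> f) = K' f" for f
    by (rule eqI) (metis adjoint adj_adj adj_ampl cinner_adj ampl_adj_fock_one_kernel)
  have \<Phi>_one: "\<Phi> (fock_one J) = q"
    by (rule bop_eqI) (simp add: \<Phi> one K'K)
  have "q \<cdot> K' f = K' f" for f
    by (rule eqI) (metis adjoint cinner_adj q_adj kernel_q[OF r])
  then have "fock_one J \<in> N"
    by (simp add: N_def one \<Phi>_one)
  moreover have gen: "K' (ampl (creation J i) \<cdot> f) = complex_of_real r *\<^sub>C (S i \<cdot> K' f)" for i f
  proof (rule eqI)
    fix h
    have "cinner (K' (ampl (creation J i) \<cdot> f)) h = cinner f (ampl (adj (creation J i)) \<cdot> ?K h)"
      by (simp add: adjoint cinner_adj_right flip: adj_ampl)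
    also have "\<dots> = cinner (complex_of_real r *\<^sub>C (S i \<cdot> K' f)) h"
      by (simp add: ampl_adj_creation_kernel adjoint[symmetric] cinner_scaleC_left
          cinner_scaleC_right cinner_adj_right)
    finally show "cinner (K' (ampl (creation J i) \<cdot> f)) h
        = cinner (complex_of_real r *\<^sub>C (S i \<cdot> K' f)) h" .
  qed
  have \<Phi>_gen: "\<Phi> (creation J i) = complex_of_real r *\<^sub>C S i" for i
  proof (rule bop_eqI)
    fix h
    have "S i \<cdot> q \<cdot> h = S i \<cdot> h"
      using S_q[of i] by (metis bop_simps(4))
    then show "\<Phi> (creation J i) \<cdot> h = (complex_of_real r *\<^sub>C S i) \<cdot> h"
      by (simp add: \<Phi> gen K'K bop_simps)
  qed
  have "creation J i \<in> N" for i
    by (simp add: N_def gen \<Phi>_gen bop_simps)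
  ultimately have "tensor_algebra J \<subseteq> N"
    unfolding tensor_algebra_def by (intro hull_minimal) auto
  then have "alg_hom_on (tensor_algebra J) \<Phi>"
    unfolding alg_hom_on_def clinear_on_def mult_on_def using \<Phi>_add \<Phi>_scale mult by blast
  with contractive \<Phi>_one \<Phi>_gen show ?thesis
    by blast
qed

end

text \<open>The limit of the Poisson transforms as \<open>r\<close> tends to \<open>1\<close>. It exists on the generators by
  inspection, and on the tensor algebra because the transforms are uniformly bounded.\<close>

theorem von_Neumann_hom:
  fixes J :: "'d ncpoly set"
  assumes vanish: "\<And>\<mu>. \<mu> \<notin> allowed_words J \<Longrightarrow> word_op \<mu> = 0"
    and B: "closed_algebra B" "q \<in> B" "\<And>i. S i \<in> B"
  obtains \<phi> where "alg_hom_on (tensor_algebra J) \<phi>" "\<phi> ` tensor_algebra J \<subseteq> B"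
    "\<forall>n x. (\<forall>i<n. \<forall>j<n. x i j \<in> tensor_algebra J) \<longrightarrow>
       matrix_norm n (\<lambda>i j. \<phi> (x i j)) \<le> matrix_norm n x"
    "\<phi> (fock_one J) = q" "\<forall>i. \<phi> (creation J i) = S i"
proof -
  let ?TA = "tensor_algebra J"
  define r :: "nat \<Rightarrow> real" where "r m = real m / real (Suc m)" for m
  have r: "0 \<le> r m" "r m < 1" for m
    by (simp_all add: r_def)
  have r_lim: "r \<longlonglongrightarrow> 1"
    unfolding r_def by (rule LIMSEQ_n_over_Suc_n)
  have "\<exists>\<Phi>. \<forall>m. alg_hom_on ?TA (\<Phi> m) \<and>
     (\<forall>n x. matrix_norm n (\<lambda>i j. \<Phi> m (x i j)) \<le> matrix_norm n x) \<and>
     \<Phi> m (fock_one J) = q \<and> (\<forall>i. \<Phi> m (creation J i) = complex_of_real (r m) *\<^sub>C S i)"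
    using poisson_transform[OF r vanish] by (intro choice) blast
  then obtain \<Phi> where hom: "\<And>m. alg_hom_on ?TA (\<Phi> m)"
    and contr: "\<And>m n x. matrix_norm n (\<lambda>i j. \<Phi> m (x i j)) \<le> matrix_norm n x"
    and one: "\<And>m. \<Phi> m (fock_one J) = q"
    and gen: "\<And>m i. \<Phi> m (creation J i) = complex_of_real (r m) *\<^sub>C S i"
    by blast
  have TA: "closed_algebra ?TA"
    unfolding tensor_algebra_def by (rule closed_algebra_hull)
  have sub: "csubspace ?TA"
    by (rule closed_algebraD(1)[OF TA])
  note lin = alg_hom_onD(1)[OF hom] and mult = alg_hom_onD(2)[OF hom]
  have norm_diff: "norm (\<Phi> m x - \<Phi> m y) \<le> norm (x - y)" if "x \<in> ?TA" "y \<in> ?TA" for m x y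
    using contr[of 1 m "\<lambda>i j. x - y"] clinear_on_diff[OF lin[of m] sub that]
    by (simp only: matrix_norm_1)
  define \<phi> where "\<phi> x = lim (\<lambda>m. \<Phi> m x)" for x
  \<comment> \<open>Norm limits of elements with a limit have one too, by an \<open>e / 3\<close> argument; hence \<open>G\<close> is a
    closed algebra containing the generators, that is, all of the tensor algebra.\<close>
  define G where "G = {x \<in> ?TA. \<exists>L\<in>B. (\<lambda>m. \<Phi> m x) \<longlonglongrightarrow> L}"
  have lim: "(\<lambda>m. \<Phi> m x) \<longlonglongrightarrow> \<phi> x" and in_B: "\<phi> x \<in> B" if "x \<in> G" for x
    using that limI unfolding G_def \<phi>_def by blast+
  have G_I: "x \<in> G" if "x \<in> ?TA" "L \<in> B" "(\<lambda>m. \<Phi> m x) \<longlonglongrightarrow> L" for x L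
    using that unfolding G_def by blast
  have G_TA: "x \<in> ?TA" if "x \<in> G" for x
    using that by (simp add: G_def)
  have B_sub: "csubspace B"
    by (rule closed_algebraD(1)[OF B(1)])
  have lim_add: "(\<lambda>m. \<Phi> m (x + y)) \<longlonglongrightarrow> \<phi> x + \<phi> y" if "x \<in> G" "y \<in> G" for x y
    using tendsto_add[OF lim[OF that(1)] lim[OF that(2)]]
    by (simp add: clinear_onD(1)[OF lin G_TA[OF that(1)] G_TA[OF that(2)]])
  have lim_mult: "(\<lambda>m. \<Phi> m (x * y)) \<longlonglongrightarrow> \<phi> x * \<phi> y" if "x \<in> G" "y \<in> G" for x y
    using tendsto_mult[OF lim[OF that(1)] lim[OF that(2)]]
    by (simp add: mult[OF G_TA[OF that(1)] G_TA[OF that(2)]])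
  have lim_scale: "(\<lambda>m. \<Phi> m (c *\<^sub>C x)) \<longlonglongrightarrow> c *\<^sub>C \<phi> x" if "x \<in> G" for c x
    using bounded_linear.tendsto[OF bounded_linear_scaleC_bop lim[OF that], of c]
    by (simp add: clinear_onD(2)[OF lin G_TA[OF that]])
  have "closed G"
    unfolding closed_sequential_limits
  proof (intro allI impI, elim conjE)
    fix X x assume X: "\<forall>k. X k \<in> G" and Xx: "X \<longlonglongrightarrow> x"
    have x: "x \<in> ?TA"
      using closed_sequentially[OF closed_algebraD(3)[OF TA] _ Xx] X G_TA by blast
    have near: "\<exists>y\<in>G. norm (x - y) < e" if "0 < e" for e
      using LIMSEQ_D[OF Xx that] X by (metis norm_minus_commute order_refl)
    have "Cauchy (\<lambda>m. \<Phi> m x)"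
    proof (rule CauchyI)
      fix e :: real assume e: "0 < e"
      obtain y where y: "y \<in> G" "norm (x - y) < e / 3"
        using near[of "e / 3"] e by auto
      have "Cauchy (\<lambda>m. \<Phi> m y)"
        using lim[OF y(1)] by (rule LIMSEQ_imp_Cauchy)
      then obtain M where M: "\<And>m n. m \<ge> M \<Longrightarrow> n \<ge> M \<Longrightarrow> norm (\<Phi> m y - \<Phi> n y) < e / 3"
        using CauchyD[of "\<lambda>m. \<Phi> m y" "e / 3"] e by auto
      have "norm (\<Phi> m x - \<Phi> n x) < e" if "m \<ge> M" "n \<ge> M" for m n
      proof -
        have "\<Phi> m x - \<Phi> n x = (\<Phi> m x - \<Phi> m y) + (\<Phi> m y - \<Phi> n y) + (\<Phi> n y - \<Phi> n x)"
          by simp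
        also have "norm \<dots> \<le> norm (\<Phi> m x - \<Phi> m y) + norm (\<Phi> m y - \<Phi> n y) + norm (\<Phi> n y - \<Phi> n x)"
          by (intro order_trans[OF norm_triangle_ineq] add_mono norm_triangle_ineq order_refl)
        also have "\<dots> < e"
          using norm_diff[OF x G_TA[OF y(1)], of m] norm_diff[OF G_TA[OF y(1)] x, of n] M[OF that] y(2)
          by (simp add: norm_minus_commute)
        finally show ?thesis .
      qed
      then show "\<exists>M. \<forall>m\<ge>M. \<forall>n\<ge>M. norm (\<Phi> m x - \<Phi> n x) < e"
        by blast
    qed
    then obtain L where L: "(\<lambda>m. \<Phi> m x) \<longlonglongrightarrow> L"
      using Cauchy_convergent convergent_def by blast
    have "L \<in> closure B"
      unfolding closure_approachable
    proof (intro allI impI)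
      fix e :: real assume e: "0 < e"
      obtain y where y: "y \<in> G" "norm (x - y) < e"
        using near[OF e] by blast
      have "norm (L - \<phi> y) \<le> norm (x - y)"
        using norm_diff[OF x G_TA[OF y(1)]]
        by (intro LIMSEQ_le_const2[OF tendsto_norm[OF tendsto_diff[OF L lim[OF y(1)]]]]) auto
      then show "\<exists>z\<in>B. dist z L < e"
        using in_B[OF y(1)] y(2) by (intro bexI[of _ "\<phi> y"]) (auto simp: dist_norm norm_minus_commute)
    qed
    then have "L \<in> B"
      by (simp add: closure_closed[OF closed_algebraD(3)[OF B(1)]])
    then show "x \<in> G"
      by (rule G_I[OF x _ L])
  qed
  moreover have "csubspace G"
    unfolding csubspace_def
  proof (intro conjI ballI allI)
    have "(\<lambda>m. \<Phi> m 0) \<longlonglongrightarrow> 0"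
      by (simp add: clinear_on_zero[OF lin sub])
    then show "0 \<in> G"
      by (intro G_I[OF csubspaceD(1)[OF sub] csubspaceD(1)[OF B_sub]])
    show "x + y \<in> G" if "x \<in> G" "y \<in> G" for x y
      using that by (intro G_I[OF _ _ lim_add] csubspaceD(2)[OF sub] csubspaceD(2)[OF B_sub] G_TA in_B)
    show "c *\<^sub>C x \<in> G" if "x \<in> G" for c x
      using that by (intro G_I[OF _ _ lim_scale] csubspaceD(3)[OF sub] csubspaceD(3)[OF B_sub] G_TA in_B)
  qed
  moreover have "x * y \<in> G" if "x \<in> G" "y \<in> G" for x y
    using that by (intro G_I[OF _ _ lim_mult] closed_algebraD(2)[OF TA] closed_algebraD(2)[OF B(1)] G_TA in_B)
  ultimately have "closed_algebra G"
    unfolding closed_algebra_def by blast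
  moreover have lim_one: "(\<lambda>m. \<Phi> m (fock_one J)) \<longlonglongrightarrow> q"
    by (simp add: one)
  have lim_gen: "(\<lambda>m. \<Phi> m (creation J i)) \<longlonglongrightarrow> S i" for i
  proof -
    have "(\<lambda>m. r m *\<^sub>R S i) \<longlonglongrightarrow> 1 *\<^sub>R S i"
      by (intro tendsto_intros r_lim)
    then show ?thesis
      by (simp add: gen scaleR_scaleC scaleC_one)
  qed
  have gens: "fock_one J \<in> ?TA" "creation J i \<in> ?TA" for i
    unfolding tensor_algebra_def by (auto intro!: hull_inc)
  ultimately have "?TA \<subseteq> G"
    using G_I[OF gens(1) B(2) lim_one] G_I[OF gens(2) B(3) lim_gen]
    unfolding tensor_algebra_def[of J] by (intro hull_minimal) auto
  then have TA_G: "x \<in> G" if "x \<in> ?TA" for x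
    using that by blast
  show thesis
  proof (rule that[of \<phi>])
    show "alg_hom_on ?TA \<phi>"
      unfolding alg_hom_on_def clinear_on_def mult_on_def \<phi>_def[of "_ + _"] \<phi>_def[of "_ * _"]
        \<phi>_def[of "_ *\<^sub>C _"]
      using limI[OF lim_add[OF TA_G TA_G]] limI[OF lim_mult[OF TA_G TA_G]] limI[OF lim_scale[OF TA_G]]
      by blast
    show "\<phi> ` ?TA \<subseteq> B"
      using in_B TA_G by blast
    show "\<forall>n x. (\<forall>i<n. \<forall>j<n. x i j \<in> ?TA) \<longrightarrow>
        matrix_norm n (\<lambda>i j. \<phi> (x i j)) \<le> matrix_norm n x"
    proof (intro allI impI)
      fix n and x :: "nat \<Rightarrow> nat \<Rightarrow> 'd list bop"
      assume x: "\<forall>i<n. \<forall>j<n. x i j \<in> ?TA"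
      have "(\<lambda>m. matrix_norm n (\<lambda>i j. \<Phi> m (x i j))) \<longlonglongrightarrow> matrix_norm n (\<lambda>i j. \<phi> (x i j))"
        unfolding matrix_norm_eq_norm_block block_def
        by (intro tendsto_norm tendsto_sum
            bounded_linear.tendsto[OF bounded_linear_corner[OF inj_leg inj_leg]] lim TA_G)
          (use x in auto)
      then show "matrix_norm n (\<lambda>i j. \<phi> (x i j)) \<le> matrix_norm n x"
        by (rule LIMSEQ_le_const2) (use contr in auto)
    qed
    show "\<phi> (fock_one J) = q" "\<forall>i. \<phi> (creation J i) = S i"
      unfolding \<phi>_def using limI[OF lim_one] limI[OF lim_gen] by auto
  qed
qed

end

section \<open>Monomial ideals and creation operators\<close>

lemma two_sided_ideal_monomial_ideal:
  assumes "monomial_ideal J"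
  shows "two_sided_ideal J"
proof -
  obtain M where M: "J = two_sided_ideal hull (ncmonomial ` M)"
    using assms unfolding monomial_ideal_def by blast
  show ?thesis
    unfolding M by (rule hull_in) (auto simp: two_sided_ideal_def)
qed

lemma allowed_words_appendD:
  assumes "two_sided_ideal J" "\<mu> @ \<nu> \<in> allowed_words J"
  shows "\<mu> \<in> allowed_words J" "\<nu> \<in> allowed_words J"
proof -
  have "ncmonomial (\<mu> @ \<nu>) = ncmonomial \<mu> * ncmonomial \<nu>"
    by (simp add: ncmonomial_def)
  then show "\<mu> \<in> allowed_words J" "\<nu> \<in> allowed_words J"
    using assms unfolding allowed_words_def two_sided_ideal_def by auto
qed

lemma cinner_ket_ket: "cinner (ket i) (ket j) = (if i = j then 1 else 0)"
  by (simp add: cinner_ket ket.rep_eq)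

lemma adj_mult_ket_eqI:
  assumes "\<And>\<kappa>. cinner (S \<cdot> ket \<kappa>) (T \<cdot> ket \<nu>) = ell2_apply x \<kappa>"
  shows "(adj S * T) \<cdot> ket \<nu> = x"
  by (rule ell2_eqI) (simp add: bop_simps cinner_adj_right assms flip: cinner_ket)

text \<open>On the Fock space this is the projection onto the span of the \<open>ket \<nu>\<close> with \<open>\<mu> @ \<nu>\<close>
  allowed; the projections with \<open>\<mu>\<close> allowed generate the coefficient algebra.\<close>

definition source_proj :: "'d ncpoly set \<Rightarrow> 'd list \<Rightarrow> 'd list bop" where
  "source_proj J \<mu> = adj (creation_word J \<mu>) * creation_word J \<mu>"

context
  fixes J :: "('d::finite) ncpoly set"
  assumes ideal: "two_sided_ideal J"
begin

lemma allowed_words_ConsD: "i # \<nu> \<in> allowed_words J \<Longrightarrow> \<nu> \<in> allowed_words J"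
  using allowed_words_appendD(2)[OF ideal, of "[i]" \<nu>] by simp

lemma creation_word_ket:
  "creation_word J \<mu> \<cdot> ket \<nu> = (if \<mu> @ \<nu> \<in> allowed_words J then ket (\<mu> @ \<nu>) else 0)"
  by (induction \<mu>) (auto simp: fock_one_ket bop_simps creation_ket dest: allowed_words_ConsD)

lemma source_proj_ket:
  "source_proj J \<mu> \<cdot> ket \<nu> = (if \<mu> @ \<nu> \<in> allowed_words J then ket \<nu> else 0)"
  unfolding source_proj_def
  by (rule adj_mult_ket_eqI)
    (auto simp: creation_word_ket cinner_ket_ket ket.rep_eq zero_ell2.rep_eq)

lemma source_proj_not_allowed: "\<mu> \<notin> allowed_words J \<Longrightarrow> source_proj J \<mu> = 0"
  by (rule bop_eq_on_ket) (auto simp: source_proj_ket bop_simps dest: allowed_words_appendD(1)[OF ideal])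

lemma source_proj_Nil: "source_proj J [] = fock_one J"
  by (rule bop_eq_on_ket) (simp add: source_proj_ket fock_one_ket)

lemma fock_one_idem: "fock_one J * fock_one J = fock_one J"
  by (rule bop_eq_on_ket) (simp add: fock_one_ket bop_simps)

lemma adj_fock_one: "adj (fock_one J) = fock_one J"
  by (metis source_proj_Nil source_proj_def adj_mult adj_adj)

lemma fock_one_creation: "fock_one J * creation J i = creation J i"
  by (rule bop_eq_on_ket) (simp add: fock_one_ket creation_ket bop_simps)

lemma creation_fock_one: "creation J i * fock_one J = creation J i"
  by (rule bop_eq_on_ket) (simp add: fock_one_ket creation_ket bop_simps)

lemma fock_one_source_proj: "fock_one J * source_proj J \<mu> = source_proj J \<mu>"
  by (rule bop_eq_on_ket)
    (auto simp: fock_one_ket source_proj_ket bop_simps dest: allowed_words_appendD(2)[OF ideal])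

lemma source_proj_fock_one: "source_proj J \<mu> * fock_one J = source_proj J \<mu>"
  by (rule bop_eq_on_ket)
    (auto simp: fock_one_ket source_proj_ket bop_simps dest: allowed_words_appendD(2)[OF ideal])

lemma source_proj_creation:
  "source_proj J \<mu> * creation J j = creation J j * source_proj J (\<mu> @ [j])"
  by (rule bop_eq_on_ket) (simp add: source_proj_ket creation_ket bop_simps)

lemma adj_creation_creation: "adj (creation J i) * creation J i = source_proj J [i]"
  by (simp add: source_proj_def creation_fock_one)

lemma creation_source_proj: "creation J i * source_proj J [i] = creation J i"
  by (rule bop_eq_on_ket) (simp add: source_proj_ket creation_ket bop_simps)

lemma creation_orthogonal: "i \<noteq> j \<Longrightarrow> adj (creation J i) * creation J j = 0"
  by (rule bop_eq_on_ket)
    (auto simp: bop_simps(5) creation_ket cinner_ket_ket zero_ell2.rep_eq intro!: adj_mult_ket_eqI)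

section \<open>Toeplitz representations\<close>

lemma cstar_coeff_algebra: "cstar_algebra (coeff_algebra J)"
  unfolding coeff_algebra_def by (rule cstar_algebra_hull)

lemma source_proj_in_coeff_algebra: "source_proj J \<mu> \<in> coeff_algebra J"
proof (cases "\<mu> \<in> allowed_words J")
  case True
  then show ?thesis
    unfolding coeff_algebra_def source_proj_def by (intro hull_inc) blast
next
  case False
  then show ?thesis
    using csubspaceD(1)[OF closed_algebraD(1)[OF cstar_algebraD(1)[OF cstar_coeff_algebra]]]
    by (simp add: source_proj_not_allowed)
qed

lemma fock_one_in_coeff_algebra: "fock_one J \<in> coeff_algebra J"
  using source_proj_in_coeff_algebra[of "[]"] by (simp add: source_proj_Nil)

lemma creation_mult_in_correspondence: "a \<in> coeff_algebra J \<Longrightarrow> creation J i * a \<in> correspondence J"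
  unfolding correspondence_def by (intro subsetD[OF closure_subset] hull_inc) blast

lemma creation_in_correspondence: "creation J i \<in> correspondence J"
  using creation_mult_in_correspondence[OF fock_one_in_coeff_algebra] by (simp add: creation_fock_one)

context
  fixes \<pi> t :: "'d list bop \<Rightarrow> 'h bop"
  assumes rep: "toeplitz_rep (coeff_algebra J) (correspondence J) \<pi> t"
begin

lemma \<pi>_star_hom: "star_hom_on (coeff_algebra J) \<pi>"
  and t_inner: "\<xi> \<in> correspondence J \<Longrightarrow> \<eta> \<in> correspondence J \<Longrightarrow> adj (t \<xi>) * t \<eta> = \<pi> (adj \<xi> * \<eta>)"
  and t_left: "a \<in> coeff_algebra J \<Longrightarrow> \<xi> \<in> correspondence J \<Longrightarrow> \<pi> a * t \<xi> = t (a * \<xi>)"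
  using rep unfolding toeplitz_rep_def by blast+

lemma \<pi>_mult: "a \<in> coeff_algebra J \<Longrightarrow> b \<in> coeff_algebra J \<Longrightarrow> \<pi> (a * b) = \<pi> a * \<pi> b"
  by (rule alg_hom_onD(2)[OF star_hom_onD(1)[OF \<pi>_star_hom]])

lemma \<pi>_zero: "\<pi> 0 = 0"
  using clinear_on_zero[OF alg_hom_onD(1)[OF star_hom_onD(1)[OF \<pi>_star_hom]]
      closed_algebraD(1)[OF cstar_algebraD(1)[OF cstar_coeff_algebra]]] .

text \<open>Compatibility with the right action is a consequence of the axioms: the difference \<open>X\<close> of the
  two sides satisfies \<open>X\<^sup>*X = 0\<close>.\<close>

lemma t_right:
  assumes a: "a \<in> coeff_algebra J"
  shows "t (creation J i * a) = t (creation J i) * \<pi> a"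
proof -
  let ?T = "creation J i" and ?Q = "source_proj J [i]"
  let ?X = "t (?T * a) - t ?T * \<pi> a"
  note A = closed_algebraD(2)[OF cstar_algebraD(1)[OF cstar_coeff_algebra]]
  have E: "?T \<in> correspondence J" "?T * a \<in> correspondence J"
    by (rule creation_in_correspondence) (rule creation_mult_in_correspondence[OF a])
  have mem: "adj a \<in> coeff_algebra J" "?Q \<in> coeff_algebra J"
    by (rule cstar_algebraD(2)[OF cstar_coeff_algebra a]) (rule source_proj_in_coeff_algebra)
  have adj_\<pi>: "adj (\<pi> a) = \<pi> (adj a)"
    by (rule star_hom_onD(2)[OF \<pi>_star_hom a, symmetric])
  have 1: "adj (t (?T * a)) * t (?T * a) = \<pi> (adj a * ?Q * a)"
    and 2: "adj (t (?T * a)) * t ?T = \<pi> (adj a * ?Q)"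
    and 3: "adj (t ?T) * t (?T * a) = \<pi> (?Q * a)"
    and 4: "adj (t ?T) * t ?T = \<pi> ?Q"
    using E by (simp_all add: t_inner adj_mult mult.assoc flip: adj_creation_creation)
  have "adj ?X * ?X = adj (t (?T * a)) * t (?T * a) - adj (t (?T * a)) * t ?T * \<pi> a
      - adj (\<pi> a) * (adj (t ?T) * t (?T * a)) + adj (\<pi> a) * (adj (t ?T) * t ?T) * \<pi> a"
    by (simp add: adj_diff adj_mult algebra_simps)
  also have "\<dots> = 0"
    unfolding 1 2 3 4 adj_\<pi> using a mem by (simp add: \<pi>_mult A mult.assoc)
  finally have "?X = 0"
    by (rule adj_mult_self_eq_0)
  then show ?thesis
    by simp
qed

lemma \<pi>_source_proj_t: "\<pi> (source_proj J \<mu>) * t (creation J j) = t (creation J j) * \<pi> (source_proj J (\<mu> @ [j]))"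
  by (simp add: t_left source_proj_in_coeff_algebra creation_in_correspondence source_proj_creation t_right)

lemma t_source_proj: "t (creation J i) * \<pi> (source_proj J [i]) = t (creation J i)"
  by (simp add: creation_source_proj source_proj_in_coeff_algebra flip: t_right)

lemma toeplitz_orthogonal_partial_isometries:
  "orthogonal_partial_isometries (\<lambda>i. t (creation J i)) (\<pi> (fock_one J))"
proof
  note e = fock_one_in_coeff_algebra and T = creation_in_correspondence
  show "\<pi> (fock_one J) * \<pi> (fock_one J) = \<pi> (fock_one J)"
    by (simp add: fock_one_idem e flip: \<pi>_mult)
  show "adj (\<pi> (fock_one J)) = \<pi> (fock_one J)"
    using star_hom_onD(2)[OF \<pi>_star_hom e] by (simp add: adj_fock_one)
  show "\<pi> (fock_one J) * t (creation J i) = t (creation J i)" for i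
    by (simp add: t_left[OF e T] fock_one_creation)
  show "t (creation J i) * \<pi> (fock_one J) = t (creation J i)" for i
    by (simp add: creation_fock_one flip: t_right[OF e])
  show "adj (t (creation J i)) * t (creation J j) = 0" if "i \<noteq> j" for i j
    by (simp add: t_inner[OF T T] creation_orthogonal[OF that] \<pi>_zero)
  show "t (creation J i) * adj (t (creation J i)) * t (creation J i) = t (creation J i)" for i
    by (simp add: mult.assoc t_inner[OF T T] adj_creation_creation t_source_proj)
qed

text \<open>Moving the source projections through the product shows \<open>S\<^sub>\<mu> = S\<^sub>\<mu> \<pi>(T\<^sub>\<mu>\<^sup>*T\<^sub>\<mu>)\<close>, so
  a Toeplitz representation respects the relations of the ideal.\<close>

lemma toeplitz_word_vanish:
  assumes "\<mu> \<notin> allowed_words J"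
  shows "orthogonal_partial_isometries.word_op (\<lambda>i. t (creation J i)) (\<pi> (fock_one J)) \<mu> = 0"
proof -
  interpret orthogonal_partial_isometries "\<lambda>i. t (creation J i)" "\<pi> (fock_one J)"
    by (rule toeplitz_orthogonal_partial_isometries)
  note e = fock_one_in_coeff_algebra and Q = source_proj_in_coeff_algebra
  have move: "\<pi> (source_proj J \<mu>) * word_op \<nu> = word_op \<nu> * \<pi> (source_proj J (\<mu> @ \<nu>))" for \<mu> \<nu>
  proof (induction \<nu> arbitrary: \<mu>)
    case Nil
    show ?case
      by (simp add: e Q fock_one_source_proj source_proj_fock_one
          flip: \<pi>_mult)
  next
    case (Cons j \<nu>)
    have "\<pi> (source_proj J \<mu>) * word_op (j # \<nu>)
        = t (creation J j) * (\<pi> (source_proj J (\<mu> @ [j])) * word_op \<nu>)"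
      by (simp add: \<pi>_source_proj_t flip: mult.assoc)
    then show ?case
      by (simp add: Cons.IH mult.assoc)
  qed
  have "word_op \<mu> = word_op \<mu> * \<pi> (source_proj J \<mu>)" for \<mu>
  proof (cases \<mu>)
    case Nil
    then show ?thesis
      by (simp add: source_proj_Nil q_idem)
  next
    case (Cons i \<nu>)
    have "word_op (i # \<nu>) = t (creation J i) * \<pi> (source_proj J [i]) * word_op \<nu>"
      by (simp add: t_source_proj)
    also have "\<dots> = word_op (i # \<nu>) * \<pi> (source_proj J ([i] @ \<nu>))"
      by (simp only: mult.assoc move word_op.simps)
    finally show ?thesis
      by (simp add: Cons)
  qed
  from this[of \<mu>] show ?thesis
    by (simp add: source_proj_not_allowed[OF assms] \<pi>_zero)
qed

text \<open>The von Neumann homomorphism of the row \<open>t(T\<^sub>i)\<close>. Its values lie in the nonselfadjoint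
  algebra of the representation because the images of the generators do.\<close>

theorem toeplitz_completely_contractive_hom:
  obtains \<phi> where "alg_hom_on (tensor_algebra J) \<phi>"
    "\<phi> ` tensor_algebra J \<subseteq> toeplitz_algebra_plus (coeff_algebra J) (correspondence J) \<pi> t"
    "\<forall>n x. (\<forall>i<n. \<forall>j<n. x i j \<in> tensor_algebra J) \<longrightarrow>
       matrix_norm n (\<lambda>i j. \<phi> (x i j)) \<le> matrix_norm n x"
    "\<phi> (fock_one J) = \<pi> (fock_one J)" "\<forall>i. \<phi> (creation J i) = t (creation J i)"
proof -
  let ?B = "toeplitz_algebra_plus (coeff_algebra J) (correspondence J) \<pi> t"
  have B: "closed_algebra ?B"
    unfolding toeplitz_algebra_plus_def by (rule closed_algebra_hull)
  have mem: "\<pi> (fock_one J) \<in> ?B" "t (creation J i) \<in> ?B" for i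
    unfolding toeplitz_algebra_plus_def
    using fock_one_in_coeff_algebra creation_in_correspondence by (auto intro!: hull_inc)
  show ?thesis
    by (rule orthogonal_partial_isometries.von_Neumann_hom
        [where J = J, OF toeplitz_orthogonal_partial_isometries toeplitz_word_vanish B mem])
      (assumption, rule that)
qed

end

end

section \<open>The complete isometry\<close>

lemma matrix_norm_le_corner:
  assumes v: "inj v"
  shows "matrix_norm n x \<le> matrix_norm n (\<lambda>i j. corner v v (x i j))"
proof (rule matrix_norm_leI[OF matrix_norm_nonneg])
  fix h
  have "push v 0 = 0"
    by (rule ell2_eqI) (simp add: ell2_apply_push[OF v] zero_ell2.rep_eq)
  then have push_sum: "push v (\<Sum>j\<in>F. f j) = (\<Sum>j\<in>F. push v (f j))" for F :: "nat set" and f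
    by (induction F rule: infinite_finite_induct) (simp_all add: push_add[OF v])
  have "norm (\<Sum>j<n. x i j \<cdot> h j) = norm (\<Sum>j<n. corner v v (x i j) \<cdot> push v (h j))" for i
    by (simp add: corner_apply[OF v v] pull_push[OF v] norm_push[OF v] flip: push_sum)
  then show "L2_set (\<lambda>i. norm (\<Sum>j<n. x i j \<cdot> h j)) {..<n}
      \<le> matrix_norm n (\<lambda>i j. corner v v (x i j)) * L2_set (\<lambda>j. norm (h j)) {..<n}"
    using matrix_norm_apply[where n = n and x = "\<lambda>i j. corner v v (x i j)" and h = "\<lambda>j. push v (h j)"]
    by (simp add: norm_push[OF v])
qed

lemma matrix_norm_cong:
  "(\<And>i j. i < n \<Longrightarrow> j < n \<Longrightarrow> x i j = y i j) \<Longrightarrow> matrix_norm n x = matrix_norm n y"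
  by (simp add: matrix_norm_eq_norm_block block_cong[of n x y])

theorem corollary7p1:
  fixes J :: "('d::finite) ncpoly set"
    and \<pi> t :: "'d list bop \<Rightarrow> 'h bop"
  assumes "monomial_ideal J"
    and "infinite (UNIV :: 'k set)"
    and "universal_toeplitz_rep TYPE('k) (coeff_algebra J) (correspondence J) \<pi> t"
  shows "\<exists>\<phi>. alg_hom_on (tensor_algebra J) \<phi> \<and>
             \<phi> ` tensor_algebra J \<subseteq> toeplitz_algebra_plus (coeff_algebra J) (correspondence J) \<pi> t \<and>
             completely_isometric_on (tensor_algebra J) \<phi>"
proof -
  let ?A = "coeff_algebra J" and ?E = "correspondence J" and ?TA = "tensor_algebra J"
  let ?C = "toeplitz_algebra ?A ?E \<pi> t"
  have ideal: "two_sided_ideal J"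
    by (rule two_sided_ideal_monomial_ideal[OF assms(1)])
  have rep: "toeplitz_rep ?A ?E \<pi> t"
    using assms(3) unfolding universal_toeplitz_rep_def by blast
  obtain \<phi> where hom: "alg_hom_on ?TA \<phi>" and range: "\<phi> ` ?TA \<subseteq> toeplitz_algebra_plus ?A ?E \<pi> t"
    and contr: "\<forall>n x. (\<forall>i<n. \<forall>j<n. x i j \<in> ?TA) \<longrightarrow>
       matrix_norm n (\<lambda>i j. \<phi> (x i j)) \<le> matrix_norm n x"
    and one: "\<phi> (fock_one J) = \<pi> (fock_one J)" and gen: "\<forall>i. \<phi> (creation J i) = t (creation J i)"
    using toeplitz_completely_contractive_hom[OF ideal rep] by blast
  have in_C: "\<phi> x \<in> ?C" if "x \<in> ?TA" for x
    using that range toeplitz_algebra_plus_subset by blast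
  obtain u :: "nat \<Rightarrow> 'k" where u: "inj u"
    using infinite_countable_subset[OF assms(2)] by blast
  define v :: "'d list \<Rightarrow> 'k" where "v = u \<circ> to_nat"
  have v: "inj v"
    unfolding v_def by (rule inj_compose[OF u inj_to_nat])
  \<comment> \<open>The identity representation of the correspondence, moved to the index type \<open>'k\<close>.\<close>
  let ?V = "corner v v"
  note V = corner_add[OF v v] corner_scaleC[OF v v] corner_mult[OF v v v] adj_corner[OF v v]
  have "toeplitz_rep ?A ?E ?V ?V"
    unfolding toeplitz_rep_def star_hom_on_def alg_hom_on_def clinear_on_def mult_on_def
    by (simp add: V)
  then obtain \<rho> where \<rho>: "star_hom_on ?C \<rho>" and \<rho>_\<pi>: "\<And>a. a \<in> ?A \<Longrightarrow> \<rho> (\<pi> a) = ?V a"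
    and \<rho>_t: "\<And>\<xi>. \<xi> \<in> ?E \<Longrightarrow> \<rho> (t \<xi>) = ?V \<xi>"
    using assms(3) unfolding universal_toeplitz_rep_def by blast
  have C: "cstar_algebra ?C"
    unfolding toeplitz_algebra_def by (rule cstar_algebra_hull)
  have TA: "closed_algebra ?TA"
    unfolding tensor_algebra_def by (rule closed_algebra_hull)
  have TA_sub: "csubspace ?TA" and C_sub: "csubspace ?C"
    using TA C by (auto dest: closed_algebraD cstar_algebraD)
  note \<phi>_lin = alg_hom_onD(1)[OF hom] and \<phi>_mult = alg_hom_onD(2)[OF hom]
  note \<rho>_lin = alg_hom_onD(1)[OF star_hom_onD(1)[OF \<rho>]] and \<rho>_mult = alg_hom_onD(2)[OF star_hom_onD(1)[OF \<rho>]]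
  \<comment> \<open>Both sides are bounded homomorphisms, so it suffices to compare them on the generators.\<close>
  define G where "G = {x \<in> ?TA. \<rho> (\<phi> x) = ?V x}"
  have "closed G"
    unfolding closed_sequential_limits
  proof (intro allI impI, elim conjE)
    fix X x assume X: "\<forall>k. X k \<in> G" and Xx: "X \<longlonglongrightarrow> x"
    have X_TA: "X k \<in> ?TA" for k
      using X by (simp add: G_def)
    have x: "x \<in> ?TA"
      using closed_sequentially[OF closed_algebraD(3)[OF TA] _ Xx] X_TA by blast
    have "norm (\<rho> (\<phi> (X k)) - \<rho> (\<phi> x)) \<le> norm (X k - x)" for k
    proof -
      have d: "X k - x \<in> ?TA"
        by (rule csubspace_diff[OF TA_sub X_TA x])
      have "\<rho> (\<phi> (X k)) - \<rho> (\<phi> x) = \<rho> (\<phi> (X k - x))"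
        by (simp add: clinear_on_diff[OF \<phi>_lin TA_sub X_TA x]
            clinear_on_diff[OF \<rho>_lin C_sub in_C[OF X_TA] in_C[OF x]])
      also have "norm \<dots> \<le> norm (\<phi> (X k - x))"
        by (rule star_hom_contractive[OF C \<rho> in_C[OF d]])
      also have "\<dots> \<le> norm (X k - x)"
        using contr[rule_format, of 1 "\<lambda>i j. X k - x"] d by (simp only: matrix_norm_1)
      finally show ?thesis .
    qed
    then have "\<forall>\<^sub>F k in sequentially. norm (\<rho> (\<phi> (X k)) - \<rho> (\<phi> x)) \<le> norm (X k - x)"
      by (intro always_eventually allI)
    then have "(\<lambda>k. \<rho> (\<phi> (X k)) - \<rho> (\<phi> x)) \<longlonglongrightarrow> 0"
      by (rule Lim_null_comparison) (rule tendsto_norm_zero[OF LIM_zero[OF Xx]])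
    then have "(\<lambda>k. \<rho> (\<phi> (X k))) \<longlonglongrightarrow> \<rho> (\<phi> x)"
      by (rule LIM_zero_cancel)
    moreover have "\<rho> (\<phi> (X k)) = ?V (X k)" for k
      using X by (simp add: G_def)
    ultimately have "(\<lambda>k. ?V (X k)) \<longlonglongrightarrow> \<rho> (\<phi> x)"
      by simp
    moreover have "(\<lambda>k. ?V (X k)) \<longlonglongrightarrow> ?V x"
      by (rule bounded_linear.tendsto[OF bounded_linear_corner[OF v v] Xx])
    ultimately have "\<rho> (\<phi> x) = ?V x"
      by (rule LIMSEQ_unique)
    with x show "x \<in> G"
      by (simp add: G_def)
  qed
  moreover have "csubspace G"
    unfolding csubspace_def G_def
    by (auto simp: V in_C csubspaceD[OF TA_sub] clinear_onD[OF \<phi>_lin] clinear_onD[OF \<rho>_lin]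
        clinear_on_zero[OF \<phi>_lin TA_sub] clinear_on_zero[OF \<rho>_lin C_sub]
        linear_0[OF bounded_linear.linear[OF bounded_linear_corner[OF v v]]])
  moreover have "x * y \<in> G" if "x \<in> G" "y \<in> G" for x y
    using that by (simp add: G_def closed_algebraD(2)[OF TA] \<phi>_mult \<rho>_mult in_C flip: V(3))
  ultimately have "closed_algebra G"
    unfolding closed_algebra_def by blast
  moreover have "fock_one J \<in> G" "creation J i \<in> G" for i
    using \<rho>_\<pi>[OF fock_one_in_coeff_algebra[OF ideal]] \<rho>_t[OF creation_in_correspondence[OF ideal, of i]]
    by (auto simp: G_def one gen tensor_algebra_def intro!: hull_inc)
  ultimately have "?TA \<subseteq> G"
    unfolding tensor_algebra_def[of J] by (intro hull_minimal) auto
  then have \<rho>_\<phi>: "\<rho> (\<phi> x) = ?V x" if "x \<in> ?TA" for x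
    using that by (auto simp: G_def)
  have "matrix_norm n (\<lambda>i j. \<phi> (x i j)) = matrix_norm n x"
    if x: "\<And>i j. i < n \<Longrightarrow> j < n \<Longrightarrow> x i j \<in> ?TA" for n x
  proof (rule antisym)
    show "matrix_norm n (\<lambda>i j. \<phi> (x i j)) \<le> matrix_norm n x"
      using contr x by blast
    have "matrix_norm n x \<le> matrix_norm n (\<lambda>i j. ?V (x i j))"
      by (rule matrix_norm_le_corner[OF v])
    also have "\<dots> = matrix_norm n (\<lambda>i j. \<rho> (\<phi> (x i j)))"
      by (rule matrix_norm_cong) (simp add: \<rho>_\<phi> x)
    also have "\<dots> \<le> matrix_norm n (\<lambda>i j. \<phi> (x i j))"
      by (rule star_hom_completely_contractive[OF C \<rho>]) (rule in_C[OF x])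
    finally show "matrix_norm n x \<le> matrix_norm n (\<lambda>i j. \<phi> (x i j))" .
  qed
  then have "completely_isometric_on ?TA \<phi>"
    unfolding completely_isometric_on_def by blast
  with hom range show ?thesis
    by blast
qed

end
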